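(* Let $\mathrm{A}$ be a complex $3$-dimensional associative algebra with nonzero multiplication. Then $\mathrm{A}$ is isomorphic to one of the commutative associative algebras $\mathrm{A}_{01},\dots,\mathrm{A}_{11}$ listed in the context or to one of the following algebras (given in a basis $e_1,e_2,e_3$; all products of basis elements not listed are zero): $\mathrm{A}_{12}$: $e_1e_2=e_3$, $e_2e_1=-e_3$; $\mathrm{A}_{13}$: $e_1e_1=e_2$, $e_1e_3=e_2$, $e_3e_1=-e_2$; $\mathrm{A}_{14}^{\alpha}$ ($\alpha\in\mathbb{C}$, $\alpha\neq0$): $e_1e_2=(1+\alpha)e_3$, $e_2e_1=(1-\alpha)e_3$; $\mathrm{A}_{15}$: $e_1e_1=e_1$, $e_1e_2=e_2$, $e_1e_3=e_3$, $e_3e_1=e_3$; $\mathrm{A}_{16}$: $e_1e_1=e_1$, $e_1e_3=e_3$, $e_2e_1=e_2$, $e_3e_1=e_3$; $\mathrm{A}_{17}$: $e_1e_1=e_1$, $e_1e_2=e_2$, $e_1e_3=e_3$; $\mathrm{A}_{18}$: $e_1e_1=e_1$, $e_2e_1=e_2$, $e_3e_1=e_3$; $\mathrm{A}_{19}$: $e_1e_1=e_1$, $e_1e_3=e_3$, $e_2e_1=e_2$; $\mathrm{A}_{20}$: $e_1e_1=e_1$, $e_1e_3=e_3$, $e_2e_2=e_2$, $e_3e_2=e_3$; $\mathrm{A}_{21}$: $e_1e_1=e_1$, $e_2e_1=e_2$; $\mathrm{A}_{22}$: $e_1e_1=e_1$, $e_1e_2=e_2$; $\mathrm{A}_{23}$: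 $e_1e_1=e_1$, $e_1e_3=e_3$, $e_2e_2=e_2$; $\mathrm{A}_{24}$: $e_1e_1=e_1$, $e_2e_2=e_2$, $e_3e_1=e_3$. All listed algebras are pairwise non-isomorphic, except that $\mathrm{A}_{14}^{\alpha}\cong\mathrm{A}_{14}^{-\alpha}$.
   Context: Associative algebras are not assumed to be unital. The commutative algebras $\mathrm{A}_{01},\dots,\mathrm{A}_{11}$ are given in a basis $e_1,e_2,e_3$; the multiplication is commutative ($e_ie_j=e_je_i$), and products neither listed nor obtained from listed ones by commutativity are zero: $\mathrm{A}_{01}$: $e_1e_1=e_1$, $e_2e_2=e_2$; $\mathrm{A}_{02}$: $e_1e_1=e_1$, $e_1e_2=e_2$; $\mathrm{A}_{03}$: $e_1e_1=e_1$; $\mathrm{A}_{04}$: $e_1e_1=e_2$; $\mathrm{A}_{05}$: $e_1e_2=e_3$; $\mathrm{A}_{06}$: $e_1e_1=e_2$, $e_1e_2=e_3$; $\mathrm{A}_{07}$: $e_1e_1=e_1$, $e_2e_2=e_2$, $e_3e_3=e_3$; $\mathrm{A}_{08}$: $e_1e_1=e_1$, $e_2e_2=e_2$, $e_2e_3=e_3$; $\mathrm{A}_{09}$: $e_1e_1=e_1$, $e_1e_2=e_2$, $e_1e_3=e_3$; $\mathrm{A}_{10}$: $e_1e_1=e_1$, $e_1e_2=e_2$, $e_1e_3=e_3$, $e_2e_2=e_3$; $\mathrm{A}_{11}$: $e_1e_1=e_1$, $e_2e_2=e_3$. *)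

theory Defs
  imports "HOL-Analysis.Analysis"
begin

text \<open>Associative algebras over a field, not assumed to be unital.\<close>

locale associative_algebra = vector_space scale
  for scale :: "'k::field \<Rightarrow> 'a::ab_group_add \<Rightarrow> 'a" +
  fixes mult :: "'a \<Rightarrow> 'a \<Rightarrow> 'a"
  assumes mult_add_left: "mult (x + y) z = mult x z + mult y z"
    and mult_add_right: "mult x (y + z) = mult x y + mult x z"
    and mult_scale_left: "mult (scale c x) y = scale c (mult x y)"
    and mult_scale_right: "mult x (scale c y) = scale c (mult x y)"
    and mult_assoc: "mult (mult x y) z = mult x (mult y z)"

definition algebra_isomorphic ::
  "('k::field \<Rightarrow> 'a::ab_group_add \<Rightarrow> 'a) \<Rightarrow> ('a \<Rightarrow> 'a \<Rightarrow> 'a) \<Rightarrow>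
   ('k \<Rightarrow> 'b::ab_group_add \<Rightarrow> 'b) \<Rightarrow> ('b \<Rightarrow> 'b \<Rightarrow> 'b) \<Rightarrow> bool" where
  "algebra_isomorphic s1 m1 s2 m2 \<longleftrightarrow>
     (\<exists>f. Vector_Spaces.linear s1 s2 f \<and> bij f \<and> (\<forall>x y. f (m1 x y) = m2 (f x) (f y)))"

text \<open>
  A multiplication table lists entries \<open>((i, j), v)\<close>, meaning \<open>e i \<cdot> e j = v\<close>.
  Products of basis vectors without an entry are zero; the first entry for a pair counts.
\<close>

type_synonym mult_table = "((3 \<times> 3) \<times> (complex ^ 3)) list"

abbreviation e :: "3 \<Rightarrow> complex ^ 3" where
  "e i \<equiv> axis i 1"

definition basis_product :: "mult_table \<Rightarrow> 3 \<Rightarrow> 3 \<Rightarrow> complex ^ 3" where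
  "basis_product t i j = (case map_of t (i, j) of Some v \<Rightarrow> v | None \<Rightarrow> 0)"

definition table_mult :: "mult_table \<Rightarrow> complex ^ 3 \<Rightarrow> complex ^ 3 \<Rightarrow> complex ^ 3" where
  "table_mult t x y = (\<Sum>i\<in>UNIV. \<Sum>j\<in>UNIV. (x $ i * y $ j) *s basis_product t i j)"

text \<open>Adds \<open>e j \<cdot> e i = v\<close> for every entry \<open>e i \<cdot> e j = v\<close>.\<close>

definition commutative_table :: "mult_table \<Rightarrow> mult_table" where
  "commutative_table t = t @ map (\<lambda>((i, j), v). ((j, i), v)) t"

datatype algebra_name =
    A01 | A02 | A03 | A04 | A05 | A06 | A07 | A08 | A09 | A10 | A11 | A12 | A13
  | A14 complex
  | A15 | A16 | A17 | A18 | A19 | A20 | A21 | A22 | A23 | A24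

text \<open>The parameter of \<open>A14\<close> must be nonzero (\<open>A14 0\<close> has the same table as \<open>A05\<close>).\<close>

definition listed :: "algebra_name \<Rightarrow> bool" where
  "listed K \<longleftrightarrow> (\<forall>\<alpha>. K = A14 \<alpha> \<longrightarrow> \<alpha> \<noteq> 0)"

fun table :: "algebra_name \<Rightarrow> mult_table" where
  "table A01 = commutative_table [((1, 1), e 1), ((2, 2), e 2)]"
| "table A02 = commutative_table [((1, 1), e 1), ((1, 2), e 2)]"
| "table A03 = commutative_table [((1, 1), e 1)]"
| "table A04 = commutative_table [((1, 1), e 2)]"
| "table A05 = commutative_table [((1, 2), e 3)]"
| "table A06 = commutative_table [((1, 1), e 2), ((1, 2), e 3)]"
| "table A07 = commutative_table [((1, 1), e 1), ((2, 2), e 2), ((3, 3), e 3)]"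
| "table A08 = commutative_table [((1, 1), e 1), ((2, 2), e 2), ((2, 3), e 3)]"
| "table A09 = commutative_table [((1, 1), e 1), ((1, 2), e 2), ((1, 3), e 3)]"
| "table A10 = commutative_table [((1, 1), e 1), ((1, 2), e 2), ((1, 3), e 3), ((2, 2), e 3)]"
| "table A11 = commutative_table [((1, 1), e 1), ((2, 2), e 3)]"
| "table A12 = [((1, 2), e 3), ((2, 1), - e 3)]"
| "table A13 = [((1, 1), e 2), ((1, 3), e 2), ((3, 1), - e 2)]"
| "table (A14 \<alpha>) = [((1, 2), (1 + \<alpha>) *s e 3), ((2, 1), (1 - \<alpha>) *s e 3)]"
| "table A15 = [((1, 1), e 1), ((1, 2), e 2), ((1, 3), e 3), ((3, 1), e 3)]"
| "table A16 = [((1, 1), e 1), ((1, 3), e 3), ((2, 1), e 2), ((3, 1), e 3)]"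
| "table A17 = [((1, 1), e 1), ((1, 2), e 2), ((1, 3), e 3)]"
| "table A18 = [((1, 1), e 1), ((2, 1), e 2), ((3, 1), e 3)]"
| "table A19 = [((1, 1), e 1), ((1, 3), e 3), ((2, 1), e 2)]"
| "table A20 = [((1, 1), e 1), ((1, 3), e 3), ((2, 2), e 2), ((3, 2), e 3)]"
| "table A21 = [((1, 1), e 1), ((2, 1), e 2)]"
| "table A22 = [((1, 1), e 1), ((1, 2), e 2)]"
| "table A23 = [((1, 1), e 1), ((1, 3), e 3), ((2, 2), e 2)]"
| "table A24 = [((1, 1), e 1), ((2, 2), e 2), ((3, 1), e 3)]"

abbreviation product_in :: "algebra_name \<Rightarrow> complex ^ 3 \<Rightarrow> complex ^ 3 \<Rightarrow> complex ^ 3" where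
  "product_in K \<equiv> table_mult (table K)"

lemma table_mult_basis: "table_mult t (e i) (e j) = basis_product t i j"
proof -
  have "table_mult t (e i) (e j) =
      (\<Sum>k\<in>UNIV. \<Sum>l\<in>UNIV. if l = j then (if k = i then basis_product t k l else 0) else 0)"
    unfolding table_mult_def by (intro sum.cong refl) (auto simp: axis_def)
  also have "\<dots> = basis_product t i j"
    by (simp add: sum.delta)
  finally show ?thesis .
qed

lemma associative_algebra_product_in: "associative_algebra (*s) (product_in K)"
proof -
  have assoc: "product_in K (product_in K x y) z = product_in K x (product_in K y z)" for x y z
    by (cases K) (simp_all add: table_mult_def basis_product_def commutative_table_def sum_3 vec_eq_iff
        forall_3 axis_def algebra_simps)
  show ?thesis
    by unfold_locales
      (simp_all only: assoc, simp_all add: table_mult_def vec_eq_iff sum_3 algebra_simps)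
qed

lemma product_in_nonzero: "\<exists>x y. product_in K x y \<noteq> 0"
proof -
  have "\<exists>i j. basis_product (table K) i j \<noteq> 0"
    if "K \<notin> range A14"
    using that by (cases K) (auto simp: basis_product_def commutative_table_def axis_eq_0_iff
        split: if_splits intro: exI[of _ 1] exI[of _ 2])
  moreover have "basis_product (table (A14 \<alpha>)) 1 2 \<noteq> 0 \<or> basis_product (table (A14 \<alpha>)) 2 1 \<noteq> 0" for \<alpha>
  proof (rule ccontr)
    assume "\<not> ?thesis"
    moreover have "basis_product (table (A14 \<alpha>)) 1 2 $ 3 = 1 + \<alpha>" "basis_product (table (A14 \<alpha>)) 2 1 $ 3 = 1 - \<alpha>"
      by (simp_all add: basis_product_def axis_def)
    ultimately have "(1 + \<alpha>) + (1 - \<alpha>) = 0"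
      by (metis add_0 zero_index)
    then show False
      by simp
  qed
  ultimately show ?thesis
    by (metis rangeE table_mult_basis)
qed

lemma product_in_commute:
  assumes "K \<in> {A01, A02, A03, A04, A05, A06, A07, A08, A09, A10, A11}"
  shows "product_in K x y = product_in K y x"
  using assms by (auto simp: table_mult_def basis_product_def commutative_table_def sum_3 algebra_simps)

end

theory Submission
  imports Defs "HOL-Computational_Algebra.Fundamental_Theorem_Algebra"
begin

text \<open>
  If \<open>x\<^sup>4 = 0\<close> for all \<open>x\<close>, either some \<open>x\<close> generates the algebra, or all squares vanish, or the product
  is a bilinear form on a plane with values in a line, and such forms are classified by their symmetric
  and skew parts. Otherwise a polynomial in some \<open>x\<close> is a nonzero idempotent, and there is a primitive
  idempotent \<open>f\<close>. Two Peirce eigenvectors complete \<open>f\<close> to a basis; their Peirce types determine nearly all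
  products, primitivity making the nontrivial part of \<open>fAf\<close> nilpotent.

  The algebras are told apart by commutativity, the dimensions of the set of nilpotent elements and of
  both annihilators, whether \<open>x\<^sup>3 = 0\<close> implies \<open>x\<^sup>2 = 0\<close>, and whether the elements of square zero are
  closed under addition. The parameter of \<open>A14\<close> is recovered up to sign because its elements of
  square zero lie in the union of two planes, which an isomorphism preserves or swaps.
\<close>

text \<open>Degree four is where the dimension enters: \<open>x\<close>, \<open>x^2\<close>,
  \<open>x^3\<close>, \<open>x^4\<close> are dependent, so failure of \<open>x^4 = 0\<close> yields
  an idempotent. Primitivity of \<open>f\<close> makes the corner fAf local, hence spanned by
  \<open>f\<close> and nilpotent elements. The exceptional Peirce case is the one where
  \<open>f\<close> annihilates both further vectors on both sides: they span an arbitrary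
  two-dimensional algebra about which \<open>f\<close> says nothing, and an idempotent
  \<open>g\<close> in it, if there is one, takes over the role of \<open>f\<close>. Both
  annihilators are compared because \<open>A15\<close> and \<open>A16\<close>, \<open>A17\<close>
  and \<open>A18\<close>, \<open>A21\<close> and \<open>A22\<close>, \<open>A23\<close> and
  \<open>A24\<close> are pairs of opposite algebras, which no left-right symmetric invariant can
  separate.\<close>

lemma linear_inv:
  assumes "Vector_Spaces.linear s1 s2 f" "bij f"
  shows "Vector_Spaces.linear s2 s1 (inv f)"
proof -
  interpret Vector_Spaces.linear s1 s2 f by fact
  have f_inv: "f (inv f x) = x" for x
    using assms(2) by (simp add: bij_is_surj surj_f_inv_f)
  have inv_f: "inv f (f x) = x" for x
    using assms(2) by (simp add: bij_is_inj)
  have "inv f (x + y) = inv f x + inv f y" for x y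
    by (metis add f_inv inv_f)
  moreover have "inv f (s2 c x) = s1 c (inv f x)" for c x
    by (metis scale f_inv inv_f)
  ultimately show ?thesis
    unfolding Vector_Spaces.linear_iff
    using vs1.vector_space_axioms vs2.vector_space_axioms by blast
qed

lemma algebra_isomorphic_sym:
  assumes "algebra_isomorphic s1 m1 s2 m2"
  shows "algebra_isomorphic s2 m2 s1 m1"
proof -
  obtain f where f: "Vector_Spaces.linear s1 s2 f" "bij f" "\<And>x y. f (m1 x y) = m2 (f x) (f y)"
    using assms unfolding algebra_isomorphic_def by blast
  have "inv f (m2 x y) = m1 (inv f x) (inv f y)" for x y
    by (metis f(2,3) bij_inv_eq_iff)
  then show ?thesis
    unfolding algebra_isomorphic_def
    using linear_inv[OF f(1,2)] bij_imp_bij_inv[OF f(2)] by blast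
qed

section \<open>Bases and coordinates in dimension three\<close>

locale threedim_algebra = associative_algebra scale mult + finite_dimensional_vector_space scale Basis
  for scale :: "complex \<Rightarrow> 'a::ab_group_add \<Rightarrow> 'a" (infixr "\<cdot>" 75)
    and mult :: "'a \<Rightarrow> 'a \<Rightarrow> 'a" (infixl "\<odot>" 76)
    and Basis :: "'a set" +
  assumes dim_UNIV: "dim UNIV = 3"
begin

lemma mult_zero_left [simp]: "0 \<odot> x = 0"
  by (metis add_cancel_right_right mult_add_left)

lemma mult_zero_right [simp]: "x \<odot> 0 = 0"
  by (metis add_cancel_right_right mult_add_right)

lemma mult_minus_left: "(- x) \<odot> y = - (x \<odot> y)"
  by (metis add.right_inverse minus_unique mult_add_left mult_zero_left)

lemma mult_minus_right: "x \<odot> (- y) = - (x \<odot> y)"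
  by (metis add.right_inverse minus_unique mult_add_right mult_zero_right)

lemma mult_diff_left: "(x - y) \<odot> z = x \<odot> z - y \<odot> z"
  by (metis mult_add_left mult_minus_left uminus_add_conv_diff add.commute)

lemma mult_diff_right: "x \<odot> (y - z) = x \<odot> y - x \<odot> z"
  by (metis mult_add_right mult_minus_right uminus_add_conv_diff add.commute)

lemmas mult_simps = mult_add_left mult_add_right mult_diff_left mult_diff_right
  mult_minus_left mult_minus_right mult_scale_left mult_scale_right

text \<open>Ordered triples instead of \<open>independent {a, b, c}\<close>: distinctness is built
  in, and a vanishing combination can be multiplied by an algebra element to isolate a
  coefficient.\<close>

definition indep3 :: "'a \<Rightarrow> 'a \<Rightarrow> 'a \<Rightarrow> bool" where
  "indep3 a b c \<longleftrightarrow> (\<forall>p q r. p \<cdot> a + q \<cdot> b + r \<cdot> c = 0 \<longrightarrow> p = 0 \<and> q = 0 \<and> r = 0)"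

lemma indep3I:
  assumes "\<And>p q r. p \<cdot> a + q \<cdot> b + r \<cdot> c = 0 \<Longrightarrow> p = 0 \<and> q = 0 \<and> r = 0"
  shows "indep3 a b c"
  using assms unfolding indep3_def by blast

lemma indep3_cong:
  assumes "indep3 a b c" "p \<cdot> a + q \<cdot> b + r \<cdot> c = p' \<cdot> a + q' \<cdot> b + r' \<cdot> c"
  shows "p = p' \<and> q = q' \<and> r = r'"
proof -
  have "(p - p') \<cdot> a + (q - q') \<cdot> b + (r - r') \<cdot> c = 0"
    using assms(2) by (simp add: scale_left_diff_distrib algebra_simps)
  then show ?thesis
    using assms(1) unfolding indep3_def by (metis eq_iff_diff_eq_0)
qed

lemma in_span_pair: "x \<in> span {a, b} \<longleftrightarrow> (\<exists>p q. x = p \<cdot> a + q \<cdot> b)"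
  unfolding span_breakdown_eq span_empty by (auto simp: algebra_simps)

lemma in_span_triple: "x \<in> span {a, b, c} \<longleftrightarrow> (\<exists>p q r. x = p \<cdot> a + q \<cdot> b + r \<cdot> c)"
  unfolding span_breakdown_eq span_empty by (auto simp: algebra_simps)

lemma indep3_of_independent:
  assumes "independent {a, b, c}" "a \<noteq> b" "a \<noteq> c" "b \<noteq> c"
  shows "indep3 a b c"
proof (rule indep3I)
  fix p q r assume "p \<cdot> a + q \<cdot> b + r \<cdot> c = 0"
  then have "(\<Sum>v\<in>{a, b, c}. (if v = a then p else if v = b then q else r) \<cdot> v) = 0"
    using assms by (simp add: add.assoc)
  from independentD[OF assms(1) _ order_refl this]
  show "p = 0 \<and> q = 0 \<and> r = 0"
    using assms by fastforce
qed

lemma independent_of_indep3: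
  assumes "indep3 a b c"
  shows "independent {a, b, c}" "card {a, b, c} = 3"
proof -
  have a: "a \<notin> span {b, c}"
  proof
    assume "a \<in> span {b, c}"
    then obtain q r where "1 \<cdot> a + 0 \<cdot> b + 0 \<cdot> c = 0 \<cdot> a + q \<cdot> b + r \<cdot> c"
      by (auto simp: in_span_pair)
    from indep3_cong[OF assms this] show False by simp
  qed
  have b: "b \<notin> span {c}"
  proof
    assume "b \<in> span {c}"
    then obtain r where "0 \<cdot> a + 1 \<cdot> b + 0 \<cdot> c = 0 \<cdot> a + 0 \<cdot> b + r \<cdot> c"
      by (auto simp: span_singleton)
    from indep3_cong[OF assms this] show False by simp
  qed
  have c: "c \<notin> span {}"
  proof
    assume "c \<in> span {}"
    then have "0 \<cdot> a + 0 \<cdot> b + 1 \<cdot> c = 0 \<cdot> a + 0 \<cdot> b + 0 \<cdot> c"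
      by simp
    from indep3_cong[OF assms this] show False by simp
  qed
  from a b c show "independent {a, b, c}"
    by (intro independent_insertI) (simp_all add: independent_empty)
  have "a \<notin> {b, c}" "b \<noteq> c" using a b span_base by blast+
  then show "card {a, b, c} = 3" by auto
qed

lemma indep3_coords:
  assumes "indep3 a b c"
  obtains p q r where "x = p \<cdot> a + q \<cdot> b + r \<cdot> c"
proof -
  have "UNIV \<subseteq> span {a, b, c}"
    using card_eq_dim[of "{a, b, c}" UNIV] independent_of_indep3[OF assms] dim_UNIV by simp
  then show thesis using that in_span_triple by blast
qed

lemma indep3_rotate: "indep3 a b c \<Longrightarrow> indep3 b c a"
  unfolding indep3_def by (metis (no_types, lifting) add.commute add.left_commute)

lemma indep3_swap: "indep3 a b c \<Longrightarrow> indep3 b a c"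
  unfolding indep3_def by (metis (no_types, lifting) add.commute add.left_commute)

definition lincomb :: "'a \<Rightarrow> 'a \<Rightarrow> 'a \<Rightarrow> complex ^ 3 \<Rightarrow> 'a" where
  "lincomb a b c v = v $ 1 \<cdot> a + v $ 2 \<cdot> b + v $ 3 \<cdot> c"

text \<open>\<open>lincomb a b c\<close> runs from coordinates to the algebra, so it is the inverse
  of the wanted isomorphism; hence the appeal to symmetry at the end. By bilinearity only nine
  products have to be compared, and later applications evaluate them with
  \<open>lincomb_simps\<close>.\<close>

lemma isomorphic_tableI:
  assumes ind: "indep3 a b c"
    and tab: "\<forall>i j. lincomb a b c (e i) \<odot> lincomb a b c (e j) = lincomb a b c (basis_product (table K) i j)"
  shows "algebra_isomorphic scale mult (*s) (product_in K)"
proof -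
  let ?f = "lincomb a b c"
  have add: "?f (v + w) = ?f v + ?f w" for v w
    by (simp add: lincomb_def algebra_simps)
  have scale: "?f (k *s v) = k \<cdot> ?f v" for k v
    by (simp add: lincomb_def algebra_simps)
  have lin: "Vector_Spaces.linear (*s) scale ?f"
    unfolding Vector_Spaces.linear_iff using add scale vec.vector_space_axioms vector_space_axioms by blast
  have expand: "v = v $ 1 *s e 1 + v $ 2 *s e 2 + v $ 3 *s e 3" for v :: "complex ^ 3"
    by (simp add: vec_eq_iff forall_3 axis_def)
  have prod: "product_in K v w = (\<Sum>i\<in>UNIV. \<Sum>j\<in>UNIV. (v $ i * w $ j) *s product_in K (e i) (e j))" for v w
    by (simp add: table_mult_basis) (simp add: table_mult_def)
  have "?f (product_in K v w) = ?f v \<odot> ?f w" for v w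
    apply (subst prod)
    \<comment> \<open>The first occurrence of \<open>v\<close> lies in the coefficients of the
      double sum; the second is the factor to be expanded. Likewise for \<open>w\<close>.\<close>
    apply (subst (2) expand[of v])
    apply (subst (2) expand[of w])
    apply (simp add: sum_3 add scale table_mult_basis tab[rule_format, symmetric] mult_simps algebra_simps)
    done
  moreover have "bij ?f"
  proof (rule bijI)
    show "inj ?f"
    proof (rule injI)
      fix v w assume "?f v = ?f w"
      then show "v = w" using indep3_cong[OF ind] by (simp add: lincomb_def vec_eq_iff forall_3)
    qed
    show "surj ?f"
      unfolding surj_def
    proof
      fix x obtain p q r where "x = p \<cdot> a + q \<cdot> b + r \<cdot> c" by (rule indep3_coords[OF ind])
      then have "x = ?f (vector [p, q, r])" by (simp add: lincomb_def)
      then show "\<exists>v. x = ?f v" ..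
    qed
  qed
  ultimately have "algebra_isomorphic (*s) (product_in K) scale mult"
    unfolding algebra_isomorphic_def using lin by blast
  then show ?thesis by (rule algebra_isomorphic_sym)
qed

lemmas lincomb_simps = forall_3 lincomb_def basis_product_def commutative_table_def axis_def

subsection \<open>Idempotents and the Peirce decomposition\<close>

text \<open>Stated for vectors that may coincide, since it is applied to powers of one
  element.\<close>

lemma dependent_four:
  obtains p q r s where "p \<cdot> w + q \<cdot> x + r \<cdot> y + s \<cdot> z = 0"
    "p \<noteq> 0 \<or> q \<noteq> 0 \<or> r \<noteq> 0 \<or> s \<noteq> 0"
proof (cases "indep3 w x y")
  case True
  then obtain p q r where "z = p \<cdot> w + q \<cdot> x + r \<cdot> y"
    by (rule indep3_coords)
  then have "p \<cdot> w + q \<cdot> x + r \<cdot> y + (-1) \<cdot> z = 0" by simp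
  then show thesis using that[of p q r "-1"] by simp
next
  case False
  then obtain p q r where "p \<cdot> w + q \<cdot> x + r \<cdot> y = 0" "p \<noteq> 0 \<or> q \<noteq> 0 \<or> r \<noteq> 0"
    unfolding indep3_def by blast
  then show thesis using that[of p q r 0] by simp
qed

lemma scale_solve:
  assumes "p \<cdot> x + y = 0" "p \<noteq> 0"
  shows "x = (- inverse p) \<cdot> y"
proof -
  have "y = - (p \<cdot> x)" using assms(1) by (simp add: eq_neg_iff_add_eq_0 add.commute)
  then show ?thesis using assms(2) by simp
qed

text \<open>
  A relation between \<open>x, x\<^sup>2, x\<^sup>3, x\<^sup>4\<close> whose lowest term has degree at most 3 gives a polynomial \<open>g\<close> in \<open>x\<close>
  without constant term such that \<open>x\<^sup>3 g = x\<^sup>3\<close>; then \<open>g\<^sup>3\<close> is a nonzero idempotent.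
\<close>

lemma nilpotent_or_idempotent:
  assumes "x \<odot> (x \<odot> (x \<odot> x)) \<noteq> 0"
  obtains f y z where "f \<noteq> 0" "f \<odot> f = f" "f = y \<odot> x" "f = x \<odot> z"
proof -
  let ?P = "\<lambda>\<alpha> \<beta> \<gamma>. x \<odot> (x \<odot> (x \<odot> (\<alpha> \<cdot> x + \<beta> \<cdot> x \<odot> x + \<gamma> \<cdot> x \<odot> (x \<odot> x)))) = x \<odot> (x \<odot> x)"
  obtain p q r s where rel: "p \<cdot> x + q \<cdot> x \<odot> x + r \<cdot> x \<odot> (x \<odot> x) + s \<cdot> x \<odot> (x \<odot> (x \<odot> x)) = 0"
    and nz: "p \<noteq> 0 \<or> q \<noteq> 0 \<or> r \<noteq> 0 \<or> s \<noteq> 0"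
    by (rule dependent_four)
  have "\<exists>\<alpha> \<beta> \<gamma>. ?P \<alpha> \<beta> \<gamma>"
  proof (cases "p = 0")
    case False
    have "x = (- inverse p) \<cdot> (q \<cdot> x \<odot> x + r \<cdot> x \<odot> (x \<odot> x) + s \<cdot> x \<odot> (x \<odot> (x \<odot> x)))"
      by (rule scale_solve) (use rel False in \<open>simp_all add: add.assoc\<close>)
    then have "x \<odot> (x \<odot> x) = x \<odot> (x \<odot> ((- inverse p) \<cdot> (q \<cdot> x \<odot> x + r \<cdot> x \<odot> (x \<odot> x) + s \<cdot> x \<odot> (x \<odot> (x \<odot> x)))))"
      by metis
    then have "?P (- inverse p * q) (- inverse p * r) (- inverse p * s)"
      by (simp add: mult_simps scale_right_distrib)
    then show ?thesis by blast
  next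
    case p: True
    show ?thesis
    proof (cases "q = 0")
      case False
      have "x \<odot> x = (- inverse q) \<cdot> (r \<cdot> x \<odot> (x \<odot> x) + s \<cdot> x \<odot> (x \<odot> (x \<odot> x)))"
        by (rule scale_solve) (use rel p False in \<open>simp_all add: add.assoc\<close>)
      then have "x \<odot> (x \<odot> x) = x \<odot> ((- inverse q) \<cdot> (r \<cdot> x \<odot> (x \<odot> x) + s \<cdot> x \<odot> (x \<odot> (x \<odot> x))))"
        by metis
      then have "?P (- inverse q * r) (- inverse q * s) 0"
        by (simp add: mult_simps scale_right_distrib)
      then show ?thesis by blast
    next
      case q: True
      show ?thesis
      proof (cases "r = 0")
        case False
        have "x \<odot> (x \<odot> x) = (- inverse r) \<cdot> (s \<cdot> x \<odot> (x \<odot> (x \<odot> x)))"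
          by (rule scale_solve) (use rel p q False in \<open>simp_all add: add.assoc\<close>)
        then have "?P (- inverse r * s) 0 0"
          by (simp add: mult_simps scale_right_distrib)
        then show ?thesis by blast
      next
        case True
        then show ?thesis using rel p q nz assms by simp
      qed
    qed
  qed
  then obtain \<alpha> \<beta> \<gamma> where P: "?P \<alpha> \<beta> \<gamma>" by blast
  define g where "g = \<alpha> \<cdot> x + \<beta> \<cdot> x \<odot> x + \<gamma> \<cdot> x \<odot> (x \<odot> x)"
  have absorb: "x \<odot> (x \<odot> (x \<odot> g)) = x \<odot> (x \<odot> x)"
    using P unfolding g_def .
  define f where "f = g \<odot> (g \<odot> g)"
  let ?g = "\<alpha> \<cdot> x + \<beta> \<cdot> x \<odot> x + \<gamma> \<cdot> x \<odot> (x \<odot> x)"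
  \<comment> \<open>Write the three left factors as polynomials in \<open>x\<close> without constant
    term: every monomial in front of the last \<open>g\<close> has degree at least 3, so
    \<open>absorb\<close> removes that \<open>g\<close>. Thus \<open>g^4 = g^3\<close>, and
    \<open>f \<odot> f = f\<close> follows.\<close>
  have "?g \<odot> (?g \<odot> (?g \<odot> g)) = ?g \<odot> (?g \<odot> ?g)"
    by (simp add: mult_simps mult_assoc absorb)
  then have "g \<odot> (g \<odot> (g \<odot> g)) = f"
    by (simp add: f_def flip: g_def)
  then have "f \<odot> g = f" by (simp add: f_def mult_assoc)
  then have "f \<odot> f = f" by (simp add: f_def mult_assoc [symmetric])
  moreover have "x \<odot> (x \<odot> (x \<odot> f)) = x \<odot> (x \<odot> x)"
    unfolding f_def by (metis absorb mult_assoc)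
  then have "f \<noteq> 0" using assms by auto
  \<comment> \<open>One \<open>x\<close> is split off from the last factor \<open>g\<close>, and
    below from the first. In this way the idempotent inherits from \<open>x\<close> whatever
    \<open>x\<close> annihilates.\<close>
  moreover have "f = (\<alpha> \<cdot> g \<odot> g + \<beta> \<cdot> g \<odot> (g \<odot> x) + \<gamma> \<cdot> g \<odot> (g \<odot> (x \<odot> x))) \<odot> x"
    unfolding f_def by (subst (3) g_def) (simp add: mult_simps mult_assoc)
  moreover have "f = x \<odot> (\<alpha> \<cdot> g \<odot> g + \<beta> \<cdot> x \<odot> (g \<odot> g) + \<gamma> \<cdot> x \<odot> (x \<odot> (g \<odot> g)))"
    unfolding f_def by (subst (1) g_def) (simp add: mult_simps mult_assoc)
  ultimately show thesis using that by blast
qed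

lemma indep3_extend:
  assumes "\<And>p q. p \<cdot> a + q \<cdot> b = 0 \<Longrightarrow> p = 0 \<and> q = 0"
  obtains c where "indep3 a b c"
proof -
  have "dim UNIV \<le> card {a, b}" if "UNIV \<subseteq> span {a, b}"
    using that by (intro dim_le_card) auto
  moreover have "card {a, b} \<le> 2" by (simp add: card_insert_if)
  ultimately obtain c where c: "c \<notin> span {a, b}" using dim_UNIV by fastforce
  have "indep3 a b c"
  proof (rule indep3I)
    fix p q r assume *: "p \<cdot> a + q \<cdot> b + r \<cdot> c = 0"
    have "r = 0"
    proof (rule ccontr)
      assume "r \<noteq> 0"
      moreover have "r \<cdot> c + (p \<cdot> a + q \<cdot> b) = 0" using * by (simp add: add.commute)
      ultimately have "c = (- inverse r) \<cdot> (p \<cdot> a + q \<cdot> b)" by (intro scale_solve)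
      also have "\<dots> = (- inverse r * p) \<cdot> a + (- inverse r * q) \<cdot> b" by (simp add: scale_right_distrib)
      finally show False using c in_span_pair by blast
    qed
    then show "p = 0 \<and> q = 0 \<and> r = 0" using * assms by simp
  qed
  then show thesis by (rule that)
qed

text \<open>For idempotent \<open>f\<close>, membership in one of the four Peirce components: left
  and right multiplication by \<open>f\<close> are commuting projections, with eigenvalues 0 and
  1.\<close>

definition peirce :: "'a \<Rightarrow> 'a \<Rightarrow> bool" where
  "peirce f x \<longleftrightarrow> (f \<odot> x = x \<or> f \<odot> x = 0) \<and> (x \<odot> f = x \<or> x \<odot> f = 0)"

text \<open>The Peirce components together span the algebra, so the basis extension can be chosen
  inside their union.\<close>

lemma peirce_extend:
  assumes idem: "f \<odot> f = f" and S: "independent S" "S \<subseteq> {x. peirce f x}"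
  obtains B where "S \<subseteq> B" "B \<subseteq> {x. peirce f x}" "independent B" "card B = 3"
proof -
  have mem: "x \<in> span {x. peirce f x}" for x
  proof -
    have *: "f \<odot> (f \<odot> y) = f \<odot> y" for y using idem by (metis mult_assoc)
    \<comment> \<open>The summands have Peirce types 11, 10, 01 and 00.\<close>
    have "x = f \<odot> (x \<odot> f) + (f \<odot> x - f \<odot> (x \<odot> f)) + (x \<odot> f - f \<odot> (x \<odot> f))
        + (x - f \<odot> x - x \<odot> f + f \<odot> (x \<odot> f))" by simp
    moreover have "peirce f (f \<odot> (x \<odot> f))" "peirce f (f \<odot> x - f \<odot> (x \<odot> f))"
      "peirce f (x \<odot> f - f \<odot> (x \<odot> f))" "peirce f (x - f \<odot> x - x \<odot> f + f \<odot> (x \<odot> f))"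
      by (simp_all add: peirce_def mult_simps mult_assoc idem *)
    ultimately show ?thesis by (metis mem_Collect_eq span_add span_base)
  qed
  obtain B where B: "S \<subseteq> B" "B \<subseteq> {x. peirce f x}" "independent B" "{x. peirce f x} \<subseteq> span B"
    using maximal_independent_subset_extend[OF S(2,1)] by metis
  then have "UNIV \<subseteq> span B" using mem by (metis UNIV_I span_mono span_span subsetD subsetI)
  then have "card B = 3" using B(3) dim_UNIV basis_card_eq_dim by (metis subset_UNIV)
  with B show thesis using that by blast
qed

lemma peirce_basis:
  assumes idem: "f \<odot> f = f" and nz: "f \<noteq> 0"
  obtains u v where "indep3 f u v" "peirce f u" "peirce f v"
proof -
  have "independent {f}" "{f} \<subseteq> {x. peirce f x}"
    using nz idem by (auto simp: peirce_def)
  then obtain B where B: "{f} \<subseteq> B" "B \<subseteq> {x. peirce f x}" "independent B" "card B = 3"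
    by (rule peirce_extend[OF idem])
  then have "card (B - {f}) = 2" by (simp add: card_Diff_singleton)
  then obtain u v where uv: "B - {f} = {u, v}" "u \<noteq> v" by (auto simp: card_2_iff)
  then have "B = {f, u, v}" using B(1) by blast
  then have "indep3 f u v" using B(3) uv by (intro indep3_of_independent) auto
  moreover have "peirce f u" "peirce f v" using \<open>B = _\<close> B(2) by auto
  ultimately show thesis by (rule that)
qed

text \<open>\<open>g\<close> is itself a Peirce vector of \<open>f\<close>, of type 00, so it can be
  kept in the basis.\<close>

lemma peirce_basis_orthogonal:
  assumes f: "f \<odot> f = f" "f \<noteq> 0" and g: "g \<odot> g = g" "g \<noteq> 0" and fg: "f \<odot> g = 0" "g \<odot> f = 0"
  obtains w where "indep3 f g w" "peirce f w"
proof -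
  have "f \<notin> span {g}"
  proof
    assume "f \<in> span {g}"
    then obtain k where "f = k \<cdot> g" by (auto simp: span_singleton)
    then have "f \<odot> f = k \<cdot> (f \<odot> g)" by (metis mult_scale_right)
    then show False using f fg by simp
  qed
  moreover have "independent {g}" using g by simp
  ultimately have "independent {f, g}" "f \<noteq> g"
    using independent_insertI[of f "{g}"] span_base[of g "{g}"] by auto
  moreover have "{f, g} \<subseteq> {x. peirce f x}" using f fg by (auto simp: peirce_def)
  ultimately obtain B where B: "{f, g} \<subseteq> B" "B \<subseteq> {x. peirce f x}" "independent B" "card B = 3"
    by (metis peirce_extend[OF f(1)])
  then have "card (B - {f, g}) = 1" using \<open>f \<noteq> g\<close> by (simp add: card_Diff_subset)
  then obtain w where w: "B - {f, g} = {w}" by (auto simp: card_1_singleton_iff)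
  then have "B = {f, g, w}" using B(1) by blast
  then have "indep3 f g w" using B(3) w \<open>f \<noteq> g\<close> by (intro indep3_of_independent) auto
  moreover have "peirce f w" using \<open>B = _\<close> B(2) by auto
  ultimately show thesis by (rule that)
qed

text \<open>Multiplying a relation by \<open>x^2\<close>, then by \<open>x\<close>, isolates its
  lowest coefficient each time.\<close>

lemma indep3_powers:
  assumes "x \<odot> (x \<odot> (x \<odot> x)) = 0" "x \<odot> (x \<odot> x) \<noteq> 0"
  shows "indep3 x (x \<odot> x) (x \<odot> (x \<odot> x))"
proof (rule indep3I)
  fix p q r assume *: "p \<cdot> x + q \<cdot> x \<odot> x + r \<cdot> x \<odot> (x \<odot> x) = 0"
  have "x \<odot> (x \<odot> (p \<cdot> x + q \<cdot> x \<odot> x + r \<cdot> x \<odot> (x \<odot> x))) = 0" by (simp add: *)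
  then have p: "p = 0" using assms by (simp add: mult_simps)
  have "x \<odot> (p \<cdot> x + q \<cdot> x \<odot> x + r \<cdot> x \<odot> (x \<odot> x)) = 0" by (simp add: *)
  then have q: "q = 0" using assms p by (simp add: mult_simps)
  show "p = 0 \<and> q = 0 \<and> r = 0" using * assms p q by simp
qed

lemma indep2_square:
  assumes "x \<odot> (x \<odot> x) = 0" "x \<odot> x \<noteq> 0" "p \<cdot> x + q \<cdot> x \<odot> x = 0"
  shows "p = 0 \<and> q = 0"
proof -
  have "x \<odot> (p \<cdot> x + q \<cdot> x \<odot> x) = 0" by (simp add: assms)
  then have p: "p = 0" using assms(1,2) by (simp add: mult_simps)
  then show ?thesis using assms by simp
qed

subsection \<open>Nilpotent algebras\<close>

abbreviation isomorphic_to :: "algebra_name \<Rightarrow> bool" where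
  "isomorphic_to K \<equiv> algebra_isomorphic scale mult (*s) (product_in K)"

lemma indep3_scale: "indep3 a b c \<Longrightarrow> k \<noteq> 0 \<Longrightarrow> indep3 a b (k \<cdot> c)"
  unfolding indep3_def by (metis mult_eq_0_iff scale_scale)

text \<open>Polarizing \<open>x^2 = 0\<close> gives anticommutativity. Associativity then kills
  \<open>x \<odot> (x \<odot> y)\<close> and \<open>(x \<odot> y) \<odot> y\<close>, so multiplying
  a relation by \<open>x\<close> on the left or by \<open>y\<close> on the right leaves a single
  coefficient.\<close>

lemma squares_zero_case:
  assumes sq: "\<And>x. x \<odot> x = 0" and nz: "x \<odot> y \<noteq> 0"
  shows "isomorphic_to A12"
proof -
  have sq': "u \<odot> (u \<odot> v) = 0" for u v by (simp add: sq flip: mult_assoc)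
  have "(x + y) \<odot> (x + y) = y \<odot> x + x \<odot> y"
    by (subst mult_add_left) (simp add: mult_add_right sq add.commute)
  then have "y \<odot> x + x \<odot> y = 0" by (simp add: sq)
  then have anti: "y \<odot> x = - (x \<odot> y)"
    by (simp add: eq_neg_iff_add_eq_0)
  have anti': "y \<odot> (x \<odot> v) = - (x \<odot> (y \<odot> v))" for v
    by (metis anti mult_minus_left mult_assoc)
  note products = sq sq' anti anti' mult_assoc mult_minus_left mult_minus_right
  have "indep3 x y (x \<odot> y)"
  proof (rule indep3I)
    fix p q r assume *: "p \<cdot> x + q \<cdot> y + r \<cdot> (x \<odot> y) = 0"
    have "x \<odot> (p \<cdot> x + q \<cdot> y + r \<cdot> (x \<odot> y)) = 0" by (simp add: *)
    then have q: "q = 0" using nz by (simp add: mult_simps products)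
    have "(p \<cdot> x + q \<cdot> y + r \<cdot> (x \<odot> y)) \<odot> y = 0" by (simp add: *)
    then have p: "p = 0" using nz by (simp add: mult_simps products)
    show "p = 0 \<and> q = 0 \<and> r = 0" using * nz p q by simp
  qed
  then show ?thesis
    by (rule isomorphic_tableI) (simp add: lincomb_simps products)
qed

text \<open>
  The basis \<open>x, y\<close> is orthogonal for the symmetric part of the form, which is nondegenerate iff \<open>d \<noteq> 0\<close>;
  \<open>k\<close> measures the skew part.
\<close>

lemma square_form_case:
  assumes ind: "indep3 x z y"
    and sq: "x \<odot> x = z" "x \<odot> y = - (k \<cdot> z)" "y \<odot> x = k \<cdot> z" "y \<odot> y = d \<cdot> z"
    and ann: "x \<odot> z = 0" "z \<odot> x = 0" "y \<odot> z = 0" "z \<odot> y = 0" "z \<odot> z = 0"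
  shows "\<exists>K. listed K \<and> isomorphic_to K"
proof (cases "d = 0")
  case d: True
  show ?thesis
  proof (cases "k = 0")
    case True
    have "isomorphic_to A04"
      by (rule isomorphic_tableI[OF ind]) (simp add: lincomb_simps sq ann d True)
    then show ?thesis by (auto simp: listed_def)
  next
    case False
    have "indep3 x z ((- inverse k) \<cdot> y)"
      using indep3_scale[OF ind, of "- inverse k"] False by simp
    then have "isomorphic_to A13"
      by (rule isomorphic_tableI) (simp add: lincomb_simps mult_simps sq ann d False)
    then show ?thesis by (auto simp: listed_def)
  qed
next
  case d: False
  \<comment> \<open>With \<open>s\<^sup>2 = - d\<close>, the vectors \<open>s x \<plusminus> y\<close> are isotropic.\<close>
  define s where "s = csqrt (- d)"
  have s2: "s * s = - d" by (metis s_def power2_csqrt power2_eq_square)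
  have s0: "s \<noteq> 0" using s2 d by auto
  \<comment> \<open>The two mixed products of the isotropic vectors add up to \<open>- 4 * d\<close>
    times \<open>z\<close>, while in \<open>A14\<close> they add up to twice the third basis vector;
    this dictates \<open>- 2 * d\<close>. Their difference then gives the parameter
    \<open>k / s\<close>.\<close>
  have "indep3 (s \<cdot> x + y) (s \<cdot> x - y) ((- 2 * d) \<cdot> z)"
  proof (rule indep3I)
    fix p q r
    assume "p \<cdot> (s \<cdot> x + y) + q \<cdot> (s \<cdot> x - y) + r \<cdot> (- 2 * d) \<cdot> z = 0"
    then have "((p + q) * s) \<cdot> x + (- 2 * d * r) \<cdot> z + (p - q) \<cdot> y = 0"
      by (simp add: algebra_simps)
    then have "(p + q) * s = 0 \<and> - 2 * d * r = 0 \<and> p - q = 0"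
      using ind unfolding indep3_def by blast
    then show "p = 0 \<and> q = 0 \<and> r = 0" using s0 d by auto
  qed
  moreover have "(s \<cdot> x + y) \<odot> (s \<cdot> x - y) = ((1 + k / s) * (- 2 * d)) \<cdot> z"
    "(s \<cdot> x - y) \<odot> (s \<cdot> x + y) = ((1 - k / s) * (- 2 * d)) \<cdot> z"
  proof -
    have *: "(1 + k / s) * (- 2 * d) = s * s + s * k + k * s - d"
      "(1 - k / s) * (- 2 * d) = s * s - s * k - k * s - d"
      using s0 s2 by (simp_all add: field_simps) algebra+
    have double: "(k * (s * 2)) \<cdot> z = (k * s) \<cdot> z + (k * s) \<cdot> z"
      by (simp flip: scale_left_distrib)
    show "(s \<cdot> x + y) \<odot> (s \<cdot> x - y) = ((1 + k / s) * (- 2 * d)) \<cdot> z"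
      "(s \<cdot> x - y) \<odot> (s \<cdot> x + y) = ((1 - k / s) * (- 2 * d)) \<cdot> z"
      unfolding * using double by (simp_all add: mult_simps sq algebra_simps)
  qed
  moreover have "(s \<cdot> x + y) \<odot> (s \<cdot> x + y) = 0" "(s \<cdot> x - y) \<odot> (s \<cdot> x - y) = 0"
    by (simp_all add: mult_simps sq s2 scale_right_distrib scale_right_diff_distrib mult.commute)
  ultimately have "isomorphic_to (if k = 0 then A05 else A14 (k / s))"
    by (intro isomorphic_tableI[of "s \<cdot> x + y" "s \<cdot> x - y" "(- 2 * d) \<cdot> z"])
      (simp_all add: lincomb_simps ann mult_add_left mult_add_right mult_diff_left mult_diff_right
        mult_scale_left mult_scale_right)
  moreover have "listed (if k = 0 then A05 else A14 (k / s))"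
    using s0 by (simp add: listed_def)
  ultimately show ?thesis by blast
qed

text \<open>Reduces to \<open>square_form_case\<close>: all products turn out to be multiples of
  \<open>z = x^2\<close>, and \<open>z\<close> annihilates everything. Unwanted coefficients of
  \<open>x \<odot> y\<close>, \<open>y \<odot> x\<close> and the \<open>y\<close>-coefficient of
  \<open>y \<odot> y\<close> vanish because they would be eigenvalues of multiplication by a
  nilpotent element; the remaining \<open>a''\<close> vanishes by associativity.\<close>

lemma cubes_zero_case:
  assumes cube: "\<And>x. x \<odot> (x \<odot> x) = 0" and nz: "x \<odot> x \<noteq> 0"
  shows "\<exists>K. listed K \<and> isomorphic_to K"
proof -
  define z where "z = x \<odot> x"
  obtain y where ind: "indep3 x z y"
    unfolding z_def by (rule indep3_extend[OF indep2_square[OF cube nz]])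
  have indD: "p = 0 \<and> q = 0 \<and> r = 0" if "p \<cdot> x + q \<cdot> z + r \<cdot> y = 0" for p q r
    using ind that unfolding indep3_def by blast
  have z0: "z \<noteq> 0" using nz by (simp add: z_def)
  have xz: "x \<odot> z = 0" "z \<odot> x = 0" "z \<odot> z = 0"
    by (simp_all add: z_def cube mult_assoc)
  have xx: "x \<odot> (x \<odot> v) = z \<odot> v" "x \<odot> (z \<odot> v) = 0" "z \<odot> (x \<odot> v) = 0" for v
    using xz by (simp_all add: z_def flip: mult_assoc)
  obtain a b c where xy: "x \<odot> y = a \<cdot> x + b \<cdot> z + c \<cdot> y" by (rule indep3_coords[OF ind])
  obtain a' b' c' where yx: "y \<odot> x = a' \<cdot> x + b' \<cdot> z + c' \<cdot> y" by (rule indep3_coords[OF ind])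
  obtain a'' b'' c'' where yy: "y \<odot> y = a'' \<cdot> x + b'' \<cdot> z + c'' \<cdot> y" by (rule indep3_coords[OF ind])
  have zy: "z \<odot> y = a \<cdot> z + c \<cdot> (x \<odot> y)"
  proof -
    have "z \<odot> y = x \<odot> (x \<odot> y)" by (simp add: xx)
    also have "\<dots> = a \<cdot> z + c \<cdot> (x \<odot> y)"
      by (subst xy) (simp add: mult_simps xz flip: z_def)
    finally show ?thesis .
  qed
  have c: "c = 0"
  proof (rule ccontr)
    assume c: "c \<noteq> 0"
    \<comment> \<open>The left side is \<open>x^3 \<odot> y = 0\<close>, so
      \<open>z \<odot> y = 0\<close>; but its \<open>y\<close>-coordinate is
      \<open>c * c\<close>.\<close>
    have "x \<odot> (z \<odot> y) = c \<cdot> (z \<odot> y)" by (subst zy) (simp add: mult_simps xz xx)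
    then have "z \<odot> y = 0" using c by (simp add: xx)
    then have "(c * a) \<cdot> x + (a + c * b) \<cdot> z + (c * c) \<cdot> y = 0"
      using zy xy by (simp add: algebra_simps)
    then show False using indD c by fastforce
  qed
  have yz: "y \<odot> z = a' \<cdot> z + c' \<cdot> (y \<odot> x)"
  proof -
    have "y \<odot> z = (y \<odot> x) \<odot> x" by (simp add: z_def mult_assoc)
    also have "\<dots> = a' \<cdot> z + c' \<cdot> (y \<odot> x)"
      by (subst yx) (simp add: mult_simps xz flip: z_def)
    finally show ?thesis .
  qed
  have c': "c' = 0"
  proof (rule ccontr)
    assume c: "c' \<noteq> 0"
    have "(y \<odot> z) \<odot> x = c' \<cdot> (y \<odot> z)" by (subst yz) (simp add: mult_simps xz mult_assoc flip: z_def)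
    then have "y \<odot> z = 0" using c by (simp add: xz mult_assoc)
    then have "(c' * a') \<cdot> x + (a' + c' * b') \<cdot> z + (c' * c') \<cdot> y = 0"
      using yz yx by (simp add: algebra_simps)
    then show False using indD c by fastforce
  qed
  have a: "a = 0"
  proof -
    have "z \<odot> (y \<odot> (y \<odot> y)) = ((z \<odot> y) \<odot> y) \<odot> y" by (simp add: mult_assoc)
    also have "\<dots> = (a * a * a) \<cdot> z" by (simp add: zy c mult_scale_left mult.assoc)
    finally show ?thesis using z0 by (simp add: cube)
  qed
  have a': "a' = 0"
  proof -
    have "(y \<odot> (y \<odot> y)) \<odot> z = y \<odot> (y \<odot> (y \<odot> z))" by (simp add: mult_assoc)
    also have "\<dots> = (a' * a' * a') \<cdot> z" by (simp add: yz c' mult_scale_right mult.assoc)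
    finally show ?thesis using z0 by (simp add: cube)
  qed
  have zy0: "z \<odot> y = 0" "y \<odot> z = 0" using zy yz a a' c c' by simp_all
  have xy': "x \<odot> y = b \<cdot> z" "y \<odot> x = b' \<cdot> z" using xy yx a a' c c' by simp_all
  have "y \<odot> (y \<odot> y) = (a'' * c'') \<cdot> x + (a'' * b' + c'' * b'') \<cdot> z + (c'' * c'') \<cdot> y"
    by (subst yy) (simp add: mult_simps zy0 xy' yy algebra_simps)
  then have c'': "c'' = 0" using indD by (fastforce simp: cube)
  have "x \<odot> (y \<odot> y) = (x \<odot> y) \<odot> y" by (simp add: mult_assoc)
  then have "a'' \<cdot> z = 0" by (simp add: yy c'' mult_simps xz xy' zy0 flip: z_def)
  then have yy': "y \<odot> y = b'' \<cdot> z" using z0 yy c'' by simp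
  \<comment> \<open>\<open>w\<close> is \<open>y\<close> made orthogonal to \<open>x\<close> for the symmetric part of the form.\<close>
  define w where "w = y - ((b + b') / 2) \<cdot> x"
  have "indep3 x z w"
  proof (rule indep3I)
    fix p q r assume "p \<cdot> x + q \<cdot> z + r \<cdot> w = 0"
    then have "(p - r * ((b + b') / 2)) \<cdot> x + q \<cdot> z + r \<cdot> y = 0"
      by (simp add: w_def algebra_simps)
    then show "p = 0 \<and> q = 0 \<and> r = 0" using indD by fastforce
  qed
  moreover have "x \<odot> x = z" by (simp add: z_def)
  moreover have "x \<odot> w = - (((b' - b) / 2) \<cdot> z)" "w \<odot> x = ((b' - b) / 2) \<cdot> z"
  proof -
    have *: "- ((b' - b) / 2) = b - (b + b') / 2" "(b' - b) / 2 = b' - (b + b') / 2"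
      by (simp_all add: field_simps)
    have "x \<odot> w = (b - (b + b') / 2) \<cdot> z"
      by (simp add: w_def mult_simps xy' scale_left_diff_distrib flip: z_def)
    then show "x \<odot> w = - (((b' - b) / 2) \<cdot> z)"
      unfolding *(1)[symmetric] scale_minus_left .
    show "w \<odot> x = ((b' - b) / 2) \<cdot> z"
      unfolding * by (simp add: w_def mult_simps xy' scale_left_diff_distrib flip: z_def)
  qed
  moreover have "w \<odot> w = (b'' - (b + b') / 2 * b - (b + b') / 2 * b' + (b + b') / 2 * ((b + b') / 2)) \<cdot> z"
    unfolding w_def using yy' xy'
    by (simp only: mult_simps flip: z_def) (simp add: algebra_simps)
  moreover have "w \<odot> z = 0" "z \<odot> w = 0" by (simp_all add: w_def mult_simps zy0 xz)
  ultimately show ?thesis using xz by (intro square_form_case[of x z w])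
qed

lemma nilpotent_classification:
  assumes nil: "\<And>x. x \<odot> (x \<odot> (x \<odot> x)) = 0" and nz: "x \<odot> y \<noteq> 0"
  shows "\<exists>K. listed K \<and> isomorphic_to K"
proof (cases "\<forall>x. x \<odot> (x \<odot> x) = 0")
  case True
  show ?thesis
  proof (cases "\<forall>x. x \<odot> x = 0")
    case True
    then have "isomorphic_to A12" using squares_zero_case nz by blast
    then show ?thesis by (auto simp: listed_def)
  next
    case False
    then show ?thesis using \<open>\<forall>x. x \<odot> (x \<odot> x) = 0\<close> cubes_zero_case by blast
  qed
next
  case False
  then obtain w where w: "w \<odot> (w \<odot> w) \<noteq> 0" by blast
  have nil': "w \<odot> (w \<odot> (w \<odot> (w \<odot> w))) = 0" by (simp add: nil)
  have "isomorphic_to A06"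
    by (rule isomorphic_tableI[OF indep3_powers[OF nil w]]) (simp add: lincomb_simps mult_assoc nil nil')
  then show ?thesis by (auto simp: listed_def)
qed

subsection \<open>Primitive idempotents\<close>

lemma indep3D:
  "indep3 a b c \<Longrightarrow> p \<cdot> a + q \<cdot> b + r \<cdot> c = 0 \<Longrightarrow> p = 0 \<and> q = 0 \<and> r = 0"
  unfolding indep3_def by blast

lemma indep3_nonzero:
  assumes "indep3 a b c"
  shows "a \<noteq> 0" "b \<noteq> 0" "c \<noteq> 0"
  using indep3D[OF assms, of 1 0 0] indep3D[OF assms, of 0 1 0] indep3D[OF assms, of 0 0 1] by auto

lemma indep3_shift:
  assumes "indep3 a b c"
  shows "indep3 a (b - k \<cdot> a) c"
proof (rule indep3I)
  fix p q r assume "p \<cdot> a + q \<cdot> (b - k \<cdot> a) + r \<cdot> c = 0"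
  then have "(p - q * k) \<cdot> a + q \<cdot> b + r \<cdot> c = 0" by (simp add: algebra_simps)
  then show "p = 0 \<and> q = 0 \<and> r = 0" using indep3D[OF assms] by fastforce
qed

text \<open>The equations \<open>f \<odot> g = g\<close> and \<open>g \<odot> f = g\<close> place
  \<open>g\<close> in the corner fAf, whose only idempotents are thus 0 and its unit
  \<open>f\<close>.\<close>

definition primitive :: "'a \<Rightarrow> bool" where
  "primitive f \<longleftrightarrow> f \<noteq> 0 \<and> f \<odot> f = f \<and>
     (\<forall>g. g \<noteq> 0 \<longrightarrow> g \<odot> g = g \<longrightarrow> f \<odot> g = g \<longrightarrow> g \<odot> f = g \<longrightarrow> g = f)"

lemma primitiveD:
  assumes "primitive f"
  shows "f \<noteq> 0" "f \<odot> f = f"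
    "g \<noteq> 0 \<Longrightarrow> g \<odot> g = g \<Longrightarrow> f \<odot> g = g \<Longrightarrow> g \<odot> f = g \<Longrightarrow> g = f"
  using assms unfolding primitive_def by blast+

lemma primitive_exists:
  assumes "g \<noteq> 0" "g \<odot> g = g"
  obtains f where "primitive f"
proof -
  \<comment> \<open>A nonzero idempotent \<open>f\<close> for which \<open>fAf\<close> has least dimension is primitive.\<close>
  define S where "S f = range (\<lambda>x. f \<odot> (x \<odot> f))" for f
  have sub: "subspace (S f)" for f
  proof (rule subspaceI)
    show "0 \<in> S f" unfolding S_def by (rule range_eqI[of _ _ 0]) simp
    show "x + y \<in> S f" if "x \<in> S f" "y \<in> S f" for x y
      using that unfolding S_def by (auto simp flip: mult_add_left mult_add_right)
    show "c \<cdot> x \<in> S f" if x: "x \<in> S f" for c x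
    proof -
      obtain y where "x = f \<odot> (y \<odot> f)" using x unfolding S_def by blast
      then have "c \<cdot> x = f \<odot> ((c \<cdot> y) \<odot> f)" by (simp add: mult_scale_left mult_scale_right)
      then show ?thesis unfolding S_def by blast
    qed
  qed
  obtain f where f: "f \<noteq> 0" "f \<odot> f = f"
    and least: "\<And>h. h \<noteq> 0 \<Longrightarrow> h \<odot> h = h \<Longrightarrow> dim (S f) \<le> dim (S h)"
    using ex_has_least_nat[of "\<lambda>f. f \<noteq> 0 \<and> f \<odot> f = f" g "\<lambda>f. dim (S f)"] assms by blast
  have "h = f" if h: "h \<noteq> 0" "h \<odot> h = h" "f \<odot> h = h" "h \<odot> f = h" for h
  proof -
    have "S h \<subseteq> S f"
    proof
      fix y assume "y \<in> S h"
      then obtain x where "y = h \<odot> (x \<odot> h)" unfolding S_def by blast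
      then have "y = f \<odot> (y \<odot> f)" using h by (metis mult_assoc)
      then show "y \<in> S f" unfolding S_def by blast
    qed
    then have "S h = S f" using least[OF h(1,2)] sub by (metis subspace_dim_equal)
    moreover have "f \<in> S f" unfolding S_def by (rule range_eqI[of _ _ f]) (simp add: f)
    ultimately obtain x where "f = h \<odot> (x \<odot> h)" unfolding S_def by blast
    then have "h \<odot> f = f" using h(2) by (metis mult_assoc)
    then show ?thesis using h by simp
  qed
  then show thesis using that f unfolding primitive_def by blast
qed

text \<open>\<open>u\<close> is a root of \<open>t^2 - q t - p\<close>, with \<open>f\<close> as
  unit. Shifting by a root \<open>c\<close> of this polynomial removes the constant term, leaving
  \<open>k = q - 2 c\<close>.\<close>

lemma quadratic_shift:
  assumes sq: "u \<odot> u = p \<cdot> f + q \<cdot> u" and f: "f \<odot> f = f" "f \<odot> u = u" "u \<odot> f = u"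
  obtains c k where "(u - c \<cdot> f) \<odot> (u - c \<cdot> f) = k \<cdot> (u - c \<cdot> f)"
proof -
  have "degree [:- p, - q, 1 :: complex:] > 0" by simp
  from alg_closed_imp_poly_has_root[OF this] obtain c :: complex where "poly [:- p, - q, 1:] c = 0" by blast
  then have p: "p = c * c - c * q" by (simp add: algebra_simps eq_neg_iff_add_eq_0)
  have "(u - c \<cdot> f) \<odot> (u - c \<cdot> f) = q \<cdot> (u - c \<cdot> f) - c \<cdot> (u - c \<cdot> f) - c \<cdot> (u - c \<cdot> f)"
    using sq[unfolded p]
    by (simp add: mult_diff_left mult_diff_right mult_scale_left mult_scale_right f algebra_simps)
  then show thesis using that[of c "q - c - c"] by (simp only: scale_left_diff_distrib)
qed

lemma idempotent_of_square:
  assumes "n \<odot> n = k \<cdot> n" "k \<noteq> 0"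
  shows "(inverse k \<cdot> n) \<odot> (inverse k \<cdot> n) = inverse k \<cdot> n"
  using assms by (simp add: mult_scale_left mult_scale_right)

text \<open>The corner fAf is spanned by \<open>f\<close> and \<open>u\<close>. For the shifted
  vector with square \<open>k \<cdot> n\<close>, a nonzero \<open>k\<close> would make
  \<open>inverse k \<cdot> n\<close> a second nonzero idempotent of the corner.\<close>

lemma primitive_square_zero:
  assumes f: "primitive f" and ind: "indep3 f u v" and u: "f \<odot> u = u" "u \<odot> f = u"
    and v: "f \<odot> (v \<odot> f) = 0"
  obtains n where "indep3 f n v" "f \<odot> n = n" "n \<odot> f = n" "n \<odot> n = 0"
proof -
  note ff = primitiveD(2)[OF f]
  obtain p q r where uu: "u \<odot> u = p \<cdot> f + q \<cdot> u + r \<cdot> v" by (rule indep3_coords[OF ind])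
  have "u \<odot> u = f \<odot> ((u \<odot> u) \<odot> f)" using u by (metis mult_assoc)
  also have "\<dots> = p \<cdot> f + q \<cdot> u" unfolding uu by (simp add: mult_simps u v ff)
  finally have sq: "u \<odot> u = p \<cdot> f + q \<cdot> u" .
  obtain c k where ck: "(u - c \<cdot> f) \<odot> (u - c \<cdot> f) = k \<cdot> (u - c \<cdot> f)"
    by (rule quadratic_shift[OF sq ff u])
  let ?n = "u - c \<cdot> f"
  have ind': "indep3 f ?n v" by (rule indep3_shift[OF ind])
  have fn: "f \<odot> ?n = ?n" "?n \<odot> f = ?n" by (simp_all add: mult_simps u ff)
  have "k = 0"
  proof (rule ccontr)
    assume k: "k \<noteq> 0"
    then have "inverse k \<cdot> ?n \<noteq> 0" using indep3_nonzero[OF ind'] by (metis nonzero_imp_inverse_nonzero scale_eq_0_iff)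
    then have "inverse k \<cdot> ?n = f"
      using primitiveD(3)[OF f] idempotent_of_square[OF ck k] fn
      by (metis mult_scale_left mult_scale_right)
    then have "(-1) \<cdot> f + inverse k \<cdot> ?n + 0 \<cdot> v = 0" by simp
    then show False using indep3D[OF ind'] by fastforce
  qed
  then show thesis using that ind' fn ck by simp
qed

text \<open>An eigenvector of left multiplication by \<open>x\<close>: split a root \<open>c\<close>
  off a polynomial relation of \<open>x\<close>. Either the cofactor \<open>w\<close> is nonzero and
  is the eigenvector, or it is a relation of lower degree with the same leading coefficient.\<close>

lemma eigenvector_exists:
  assumes unit: "\<And>x. f \<odot> x = x" "\<And>x. x \<odot> f = x" and f: "f \<noteq> 0"
  obtains c w where "w \<noteq> 0" "(x - c \<cdot> f) \<odot> w = 0"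
proof -
  have root: "\<exists>c. poly P c = 0" if "degree P > 0" for P :: "complex poly"
    using alg_closed_imp_poly_has_root[OF that] .
  have deg1: "\<exists>c w. w \<noteq> 0 \<and> (x - c \<cdot> f) \<odot> w = 0" if "q \<noteq> 0" "p \<cdot> f + q \<cdot> x = 0" for p q
  proof -
    have "x = (- inverse q) \<cdot> p \<cdot> f" using that by (intro scale_solve) (simp_all add: add.commute)
    then have "(x - (- inverse q * p) \<cdot> f) \<odot> f = 0" by simp
    then show ?thesis using f by blast
  qed
  have deg2: "\<exists>c w. w \<noteq> 0 \<and> (x - c \<cdot> f) \<odot> w = 0"
    if r: "r \<noteq> 0" and rel: "p \<cdot> f + q \<cdot> x + r \<cdot> x \<odot> x = 0" for p q r
  proof -
    obtain c where c: "poly [:p, q, r:] c = 0" using root[of "[:p, q, r:]"] r by auto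
    then have p: "p = - (c * q) - c * c * r" by (simp add: algebra_simps eq_neg_iff_add_eq_0)
    \<comment> \<open>The quotient of the polynomial by \<open>t - c\<close>, evaluated at
      \<open>x\<close>; likewise in degree three.\<close>
    let ?w = "(q + c * r) \<cdot> f + r \<cdot> x"
    have "(x - c \<cdot> f) \<odot> ?w = p \<cdot> f + q \<cdot> x + r \<cdot> x \<odot> x"
      unfolding p by (simp add: mult_simps unit algebra_simps)
    then have "(x - c \<cdot> f) \<odot> ?w = 0" using rel by simp
    then show ?thesis using deg1[OF r, of "q + c * r"] by (cases "?w = 0") blast+
  qed
  have deg3: "\<exists>c w. w \<noteq> 0 \<and> (x - c \<cdot> f) \<odot> w = 0"
    if s: "s \<noteq> 0" and rel: "p \<cdot> f + q \<cdot> x + r \<cdot> x \<odot> x + s \<cdot> x \<odot> (x \<odot> x) = 0" for p q r s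
  proof -
    obtain c where c: "poly [:p, q, r, s:] c = 0" using root[of "[:p, q, r, s:]"] s by auto
    then have p: "p = - (c * q) - c * c * r - c * c * c * s"
      by (simp add: algebra_simps eq_neg_iff_add_eq_0)
    let ?w = "(q + c * r + c * c * s) \<cdot> f + (r + c * s) \<cdot> x + s \<cdot> x \<odot> x"
    have "(x - c \<cdot> f) \<odot> ?w = p \<cdot> f + q \<cdot> x + r \<cdot> x \<odot> x + s \<cdot> x \<odot> (x \<odot> x)"
      unfolding p by (simp add: mult_simps unit algebra_simps)
    then have "(x - c \<cdot> f) \<odot> ?w = 0" using rel by simp
    then show ?thesis using deg2[OF s, of "q + c * r + c * c * s"  "r + c * s"] by (cases "?w = 0") blast+
  qed
  obtain p q r s where rel: "p \<cdot> f + q \<cdot> x + r \<cdot> x \<odot> x + s \<cdot> x \<odot> (x \<odot> x) = 0"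
    and nz: "p \<noteq> 0 \<or> q \<noteq> 0 \<or> r \<noteq> 0 \<or> s \<noteq> 0"
    by (rule dependent_four)
  have "\<exists>c w. w \<noteq> 0 \<and> (x - c \<cdot> f) \<odot> w = 0"
  proof (cases "s = 0")
    case s: True
    show ?thesis
    proof (cases "r = 0")
      case r: True
      show ?thesis
      proof (cases "q = 0")
        case True
        then show ?thesis using rel nz s r f by simp
      next
        case False
        then show ?thesis using deg1 rel s r by simp
      qed
    next
      case False
      then show ?thesis using deg2 rel s by simp
    qed
  next
    case False
    then show ?thesis using deg3 rel by simp
  qed
  then show thesis using that by blast
qed

text \<open>With a primitive unit, every element is a scalar plus a nilpotent. The scalar is an
  eigenvalue, so the shifted element is a zero divisor and has no left multiple equal to the
  unit.\<close>

lemma primitive_unit_shift: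
  assumes prim: "primitive f" and unit: "\<And>x. f \<odot> x = x" "\<And>x. x \<odot> f = x"
  obtains c n where "n = x - c \<cdot> f" "n \<odot> (n \<odot> (n \<odot> n)) = 0"
proof -
  obtain c w where cw: "w \<noteq> 0" "(x - c \<cdot> f) \<odot> w = 0"
    by (rule eigenvector_exists[OF unit primitiveD(1)[OF prim]])
  define n where "n = x - c \<cdot> f"
  have "n \<odot> (n \<odot> (n \<odot> n)) = 0"
  proof (rule ccontr)
    assume "n \<odot> (n \<odot> (n \<odot> n)) \<noteq> 0"
    then obtain g y z where g: "g \<noteq> 0" "g \<odot> g = g" "g = y \<odot> n" by (rule nilpotent_or_idempotent)
    then have "g = f" using primitiveD(3)[OF prim] unit by blast
    \<comment> \<open>But \<open>g\<close> is a left multiple of \<open>n\<close>, which kills \<open>w\<close>, while \<open>f\<close> is the unit.\<close>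
    then have "w = y \<odot> (n \<odot> w)" using g unit by (metis mult_assoc)
    then show False using cw by (simp add: n_def)
  qed
  then show thesis using that n_def by blast
qed

text \<open>A nilpotent with nonzero square makes the algebra C[t]/(t^3), which is
  \<open>A10\<close>. Otherwise the two nilpotent basis vectors have square zero and multiply to
  zero.\<close>

lemma primitive_unit_case:
  assumes prim: "primitive f" and ind: "indep3 f u v"
    and u: "f \<odot> u = u" "u \<odot> f = u" and v: "f \<odot> v = v" "v \<odot> f = v"
  shows "isomorphic_to A09 \<or> isomorphic_to A10"
proof -
  note ff = primitiveD(2)[OF prim]
  have unit: "f \<odot> x = x" "x \<odot> f = x" for x
  proof -
    obtain p q r where "x = p \<cdot> f + q \<cdot> u + r \<cdot> v" by (rule indep3_coords[OF ind])
    then show "f \<odot> x = x" "x \<odot> f = x" by (simp_all add: mult_simps u v ff)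
  qed
  show ?thesis
  proof (cases "\<exists>x. x \<odot> (x \<odot> (x \<odot> x)) = 0 \<and> x \<odot> x \<noteq> 0")
    case True
    then obtain x where x: "x \<odot> (x \<odot> (x \<odot> x)) = 0" "x \<odot> x \<noteq> 0" by blast
    have x3: "x \<odot> (x \<odot> x) = 0"
    proof (rule ccontr)
      assume nz: "x \<odot> (x \<odot> x) \<noteq> 0"
      \<comment> \<open>The unit would be a polynomial in \<open>x\<close> without constant term,
        hence killed by \<open>x^3\<close>.\<close>
      obtain p q r where *: "f = p \<cdot> x + q \<cdot> x \<odot> x + r \<cdot> x \<odot> (x \<odot> x)"
        by (rule indep3_coords[OF indep3_powers[OF x(1) nz]])
      have "x \<odot> (x \<odot> (x \<odot> f)) = 0" unfolding * by (simp add: mult_simps x)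
      then show False using nz unit by simp
    qed
    have "indep3 f x (x \<odot> x)"
    proof (rule indep3I)
      fix p q r assume *: "p \<cdot> f + q \<cdot> x + r \<cdot> x \<odot> x = 0"
      have "x \<odot> (x \<odot> (p \<cdot> f + q \<cdot> x + r \<cdot> x \<odot> x)) = 0" by (simp add: *)
      then have "p = 0" using x x3 by (simp add: mult_simps unit)
      then show "p = 0 \<and> q = 0 \<and> r = 0" using indep2_square[OF x3 x(2)] * by simp
    qed
    then have "isomorphic_to A10"
      by (rule isomorphic_tableI) (simp add: lincomb_simps unit x3 mult_assoc)
    then show ?thesis ..
  next
    case False
    obtain c m where m: "m = u - c \<cdot> f" "m \<odot> (m \<odot> (m \<odot> m)) = 0"
      by (rule primitive_unit_shift[OF prim unit])
    obtain d n where n: "n = v - d \<cdot> f" "n \<odot> (n \<odot> (n \<odot> n)) = 0"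
      by (rule primitive_unit_shift[OF prim unit])
    have sq: "m \<odot> m = 0" "n \<odot> n = 0" using False m n by blast+
    have ind': "indep3 f m n"
      using indep3_shift[OF indep3_swap[OF indep3_rotate[OF indep3_rotate[OF indep3_shift[OF ind, of c]]]], of d]
      unfolding m n by (metis indep3_rotate indep3_swap)
    \<comment> \<open>From \<open>a \<odot> (a \<odot> b) = 0\<close> the coordinates give
      \<open>r * r = 0\<close>, then \<open>p = 0\<close>; from
      \<open>(a \<odot> b) \<odot> b = 0\<close> one gets \<open>q * q = 0\<close>.\<close>
    have prod: "a \<odot> b = 0" if ind: "indep3 f a b" and sq: "a \<odot> a = 0" "b \<odot> b = 0" for a b
    proof -
      obtain p q r where ab: "a \<odot> b = p \<cdot> f + q \<cdot> a + r \<cdot> b" by (rule indep3_coords[OF ind])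
      have "0 = a \<odot> (a \<odot> b)" by (simp add: sq flip: mult_assoc)
      also have "\<dots> = (r * p) \<cdot> f + (p + r * q) \<cdot> a + (r * r) \<cdot> b"
        unfolding ab by (simp add: mult_simps unit sq ab algebra_simps)
      finally have r: "r = 0" "p = 0" using indep3D[OF ind, of "r * p" "p + r * q" "r * r"] by auto
      have "0 = (a \<odot> b) \<odot> b" by (simp add: sq mult_assoc)
      also have "\<dots> = (q * q) \<cdot> a" by (simp add: ab r mult_simps)
      finally show ?thesis using ab r indep3_nonzero[OF ind] by simp
    qed
    have "m \<odot> n = 0" "n \<odot> m = 0" using prod[OF ind' sq] prod[of n m] ind' sq
      by (metis indep3_rotate indep3_swap)+
    then have "isomorphic_to A09"
      by (intro isomorphic_tableI[OF ind']) (simp add: lincomb_simps unit sq)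
    then show ?thesis ..
  qed
qed

text \<open>In \<open>case_ij_kl\<close> the vectors satisfy \<open>fu = iu\<close>, \<open>uf = ju\<close>, \<open>fv = kv\<close>, \<open>vf = lv\<close>.\<close>

context
  fixes f u v
  assumes prim: "primitive f" and ind: "indep3 f u v"
begin

private lemma ff: "f \<odot> f = f"
  by (rule primitiveD(2)[OF prim])

private lemma ind_fvu: "indep3 f v u"
  using ind by (metis indep3_rotate indep3_swap)

private lemma coords_zero:
  "p \<cdot> f + q \<cdot> u + r \<cdot> v = 0 \<Longrightarrow> p = 0 \<and> q = 0 \<and> r = 0"
  by (rule indep3D[OF ind])

text \<open>The Peirce rule, used in all these cases: a product of types ij and kl vanishes unless j
  = k, and then has type il. Here only \<open>n \<odot> v\<close> is in doubt; it is a multiple of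
  \<open>v\<close>, and \<open>n \<odot> n = 0\<close> makes the factor zero.\<close>

lemma case_11_10:
  assumes u: "f \<odot> u = u" "u \<odot> f = u" and v: "f \<odot> v = v" "v \<odot> f = 0"
  shows "isomorphic_to A15"
proof -
  obtain n where n: "indep3 f n v" "f \<odot> n = n" "n \<odot> f = n" "n \<odot> n = 0"
    by (rule primitive_square_zero[OF prim ind u]) (simp add: v)
  obtain p q r where nv: "n \<odot> v = p \<cdot> f + q \<cdot> n + r \<cdot> v" by (rule indep3_coords[OF n(1)])
  have "(n \<odot> v) \<odot> f = 0" by (simp add: mult_assoc v)
  then have "p \<cdot> f + q \<cdot> n + 0 \<cdot> v = 0" unfolding nv by (simp add: mult_simps v n ff)
  then have pq: "p = 0" "q = 0" using indep3D[OF n(1)] by blast+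
  have "0 = n \<odot> (n \<odot> v)" by (simp add: n flip: mult_assoc)
  then have nv0: "n \<odot> v = 0" by (simp add: nv pq mult_scale_right)
  have "v \<odot> x = 0" if "f \<odot> x = x" for x by (metis that v(2) mult_assoc mult_zero_left)
  then have "v \<odot> n = 0" "v \<odot> v = 0" using n v by blast+
  moreover have "indep3 f v n" using n(1) by (metis indep3_rotate indep3_swap)
  ultimately show ?thesis by (intro isomorphic_tableI[of f v n]) (simp_all add: lincomb_simps n nv0 v ff)
qed

text \<open>\<open>case_11_10\<close> for the opposite algebra.\<close>

lemma case_11_01:
  assumes u: "f \<odot> u = u" "u \<odot> f = u" and v: "f \<odot> v = 0" "v \<odot> f = v"
  shows "isomorphic_to A16"
proof -
  obtain n where n: "indep3 f n v" "f \<odot> n = n" "n \<odot> f = n" "n \<odot> n = 0"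
    by (rule primitive_square_zero[OF prim ind u]) (simp add: v)
  obtain p q r where vn: "v \<odot> n = p \<cdot> f + q \<cdot> n + r \<cdot> v" by (rule indep3_coords[OF n(1)])
  have "f \<odot> (v \<odot> n) = 0" by (simp add: v flip: mult_assoc)
  then have "p \<cdot> f + q \<cdot> n + 0 \<cdot> v = 0" unfolding vn by (simp add: mult_simps v n ff)
  then have pq: "p = 0" "q = 0" using indep3D[OF n(1)] by blast+
  have "0 = (v \<odot> n) \<odot> n" by (simp add: n mult_assoc)
  then have vn0: "v \<odot> n = 0" by (simp add: vn pq mult_scale_left)
  have "x \<odot> v = 0" if "x \<odot> f = x" for x by (metis that v(1) mult_assoc mult_zero_right)
  then have "n \<odot> v = 0" "v \<odot> v = 0" using n v by blast+
  moreover have "indep3 f v n" using n(1) by (metis indep3_rotate indep3_swap)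
  ultimately show ?thesis by (intro isomorphic_tableI[of f v n]) (simp_all add: lincomb_simps n vn0 v ff)
qed

text \<open>The 00 component is the line of \<open>v\<close>, so
  \<open>v \<odot> v = r \<cdot> v\<close>: either \<open>v\<close> has square zero or a multiple of
  it is an idempotent orthogonal to \<open>f\<close>.\<close>

lemma case_11_00:
  assumes u: "f \<odot> u = u" "u \<odot> f = u" and v: "f \<odot> v = 0" "v \<odot> f = 0"
  shows "isomorphic_to A02 \<or> isomorphic_to A08"
proof -
  obtain n where n: "indep3 f n v" "f \<odot> n = n" "n \<odot> f = n" "n \<odot> n = 0"
    by (rule primitive_square_zero[OF prim ind u]) (simp add: v)
  have nv: "n \<odot> v = 0" "v \<odot> n = 0" using n v by (metis mult_assoc mult_zero_left mult_zero_right)+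
  obtain p q r where vv: "v \<odot> v = p \<cdot> f + q \<cdot> n + r \<cdot> v" by (rule indep3_coords[OF n(1)])
  have "f \<odot> (v \<odot> v) = 0" by (simp add: v flip: mult_assoc)
  then have "p \<cdot> f + q \<cdot> n + 0 \<cdot> v = 0" unfolding vv by (simp add: mult_simps v n ff)
  then have pq: "p = 0" "q = 0" using indep3D[OF n(1)] by blast+
  show ?thesis
  proof (cases "r = 0")
    case True
    have "isomorphic_to A02"
      by (rule isomorphic_tableI[OF n(1)]) (simp add: lincomb_simps n nv v vv pq True ff)
    then show ?thesis ..
  next
    case False
    then have "indep3 (inverse r \<cdot> v) f n"
      using indep3_scale[OF n(1), of "inverse r"] by (simp add: indep3_rotate[OF indep3_rotate])
    then have "isomorphic_to A08"
      by (rule isomorphic_tableI) (simp add: lincomb_simps mult_simps n nv v vv pq False ff)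
    then show ?thesis ..
  qed
qed

lemma case_10_10:
  assumes u: "f \<odot> u = u" "u \<odot> f = 0" and v: "f \<odot> v = v" "v \<odot> f = 0"
  shows "isomorphic_to A17"
proof -
  have "x \<odot> y = 0" if "x \<odot> f = 0" "f \<odot> y = y" for x y
    by (metis that mult_assoc mult_zero_left)
  then have "u \<odot> u = 0" "u \<odot> v = 0" "v \<odot> u = 0" "v \<odot> v = 0" using u v by blast+
  then show ?thesis
    by (intro isomorphic_tableI[OF ind]) (simp add: lincomb_simps u v ff)
qed

lemma case_01_01:
  assumes u: "f \<odot> u = 0" "u \<odot> f = u" and v: "f \<odot> v = 0" "v \<odot> f = v"
  shows "isomorphic_to A18"
proof -
  have "x \<odot> y = 0" if "x \<odot> f = x" "f \<odot> y = 0" for x y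
    by (metis that mult_assoc mult_zero_right)
  then have "u \<odot> u = 0" "u \<odot> v = 0" "v \<odot> u = 0" "v \<odot> v = 0" using u v by blast+
  then show ?thesis
    by (intro isomorphic_tableI[OF ind]) (simp add: lincomb_simps u v ff)
qed

text \<open>\<open>u \<odot> v\<close> has type 11, so it is a multiple of \<open>f\<close>, while
  \<open>v \<odot> u\<close> has type 00, which leaves only zero. Comparing
  \<open>(u \<odot> v) \<odot> u\<close> with \<open>u \<odot> (v \<odot> u)\<close> rules out a
  nonzero multiple, which would produce 2 by 2 matrix units and dimension four.\<close>

lemma case_10_01:
  assumes u: "f \<odot> u = u" "u \<odot> f = 0" and v: "f \<odot> v = 0" "v \<odot> f = v"
  shows "isomorphic_to A19"
proof -
  have sq: "u \<odot> u = 0" "v \<odot> v = 0" using u v by (metis mult_assoc mult_zero_left mult_zero_right)+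
  obtain p q r where uv: "u \<odot> v = p \<cdot> f + q \<cdot> u + r \<cdot> v" by (rule indep3_coords[OF ind])
  have "u \<odot> v = f \<odot> ((u \<odot> v) \<odot> f)" using u v by (metis mult_assoc)
  also have "\<dots> = p \<cdot> f" unfolding uv by (simp add: mult_simps u v ff)
  finally have uv: "u \<odot> v = p \<cdot> f" .
  obtain p' q' r' where vu: "v \<odot> u = p' \<cdot> f + q' \<cdot> u + r' \<cdot> v" by (rule indep3_coords[OF ind])
  have "f \<odot> (v \<odot> u) = 0" by (simp add: v flip: mult_assoc)
  then have "p' \<cdot> f + q' \<cdot> u + 0 \<cdot> v = 0" unfolding vu by (simp add: mult_simps u v ff)
  then have pq: "p' = 0" "q' = 0" using coords_zero by blast+
  have "(v \<odot> u) \<odot> f = 0" by (simp add: u mult_assoc)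
  then have vu: "v \<odot> u = 0" unfolding vu by (simp add: mult_simps pq u v ff)
  have "0 = u \<odot> (v \<odot> u)" by (simp add: vu)
  also have "\<dots> = (u \<odot> v) \<odot> u" by (simp add: mult_assoc)
  also have "\<dots> = p \<cdot> u" by (simp add: uv mult_simps u)
  finally have "u \<odot> v = 0" using indep3_nonzero[OF ind] uv by simp
  then show ?thesis
    by (intro isomorphic_tableI[OF ind_fvu]) (simp add: lincomb_simps u v ff sq vu)
qed

text \<open>By types \<open>u \<odot> v = q \<cdot> u\<close> and
  \<open>v \<odot> v = r \<cdot> v\<close>; associativity of \<open>u\<close>, \<open>v\<close>,
  \<open>v\<close> leaves \<open>q = 0\<close> or \<open>q = r\<close>. The three algebras are
  \<open>r = 0\<close>, then \<open>q = 0\<close> and \<open>q = r\<close> with \<open>r\<close>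
  nonzero.\<close>

lemma case_10_00:
  assumes u: "f \<odot> u = u" "u \<odot> f = 0" and v: "f \<odot> v = 0" "v \<odot> f = 0"
  shows "isomorphic_to A20 \<or> isomorphic_to A22 \<or> isomorphic_to A23"
proof -
  have uu: "u \<odot> u = 0" and vu: "v \<odot> u = 0" using u v by (metis mult_assoc mult_zero_left)+
  obtain p q r where uv: "u \<odot> v = p \<cdot> f + q \<cdot> u + r \<cdot> v" by (rule indep3_coords[OF ind])
  have "(u \<odot> v) \<odot> f = 0" by (simp add: v mult_assoc)
  then have p: "p = 0" using indep3_nonzero[OF ind] unfolding uv by (simp add: mult_simps u v ff)
  have "u \<odot> v = f \<odot> (u \<odot> v)" by (simp add: u flip: mult_assoc)
  also have "\<dots> = q \<cdot> u" unfolding uv by (simp add: mult_simps p u v ff)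
  finally have uv: "u \<odot> v = q \<cdot> u" .
  obtain p' q' r where vv: "v \<odot> v = p' \<cdot> f + q' \<cdot> u + r \<cdot> v" by (rule indep3_coords[OF ind])
  have "f \<odot> (v \<odot> v) = 0" by (simp add: v flip: mult_assoc)
  then have "p' \<cdot> f + q' \<cdot> u + 0 \<cdot> v = 0" unfolding vv by (simp add: mult_simps v u ff)
  then have pq: "p' = 0" "q' = 0" using coords_zero by blast+
  have "u \<odot> (v \<odot> v) = (u \<odot> v) \<odot> v" by (simp add: mult_assoc)
  then have "(r * q) \<cdot> u = (q * q) \<cdot> u" by (simp add: vv pq uv mult_simps)
  then have rq: "q = 0 \<or> q = r" using indep3_nonzero[OF ind] by auto
  show ?thesis
  proof (cases "r = 0")
    case True
    then have "isomorphic_to A22"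
      using rq by (intro isomorphic_tableI[OF ind]) (simp add: lincomb_simps u uu vu uv v vv pq ff)
    then show ?thesis by blast
  next
    case r: False
    then have ind': "indep3 f (inverse r \<cdot> v) u"
      using indep3_scale[OF ind, of "inverse r"] by (metis indep3_rotate indep3_swap nonzero_imp_inverse_nonzero)
    show ?thesis
    proof (cases "q = 0")
      case True
      have "isomorphic_to A23"
        by (rule isomorphic_tableI[OF ind']) (simp add: lincomb_simps mult_simps u uu vu uv v vv pq ff r True)
      then show ?thesis by blast
    next
      case False
      have "isomorphic_to A20"
        using rq False
        by (intro isomorphic_tableI[OF ind']) (simp add: lincomb_simps mult_simps u uu vu uv v vv pq ff r)
      then show ?thesis by blast
    qed
  qed
qed

text \<open>\<open>case_10_00\<close> for the opposite algebra. \<open>A20\<close> is its own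
  opposite with the two idempotents exchanged, which explains the swapped basis there.\<close>

lemma case_01_00:
  assumes u: "f \<odot> u = 0" "u \<odot> f = u" and v: "f \<odot> v = 0" "v \<odot> f = 0"
  shows "isomorphic_to A20 \<or> isomorphic_to A21 \<or> isomorphic_to A24"
proof -
  have uu: "u \<odot> u = 0" and uv: "u \<odot> v = 0" using u v by (metis mult_assoc mult_zero_right)+
  obtain p q r where vu: "v \<odot> u = p \<cdot> f + q \<cdot> u + r \<cdot> v" by (rule indep3_coords[OF ind])
  have "f \<odot> (v \<odot> u) = 0" by (simp add: v flip: mult_assoc)
  then have p: "p = 0" using indep3_nonzero[OF ind] unfolding vu by (simp add: mult_simps u v ff)
  have "v \<odot> u = (v \<odot> u) \<odot> f" by (simp add: u mult_assoc)
  also have "\<dots> = q \<cdot> u" unfolding vu by (simp add: mult_simps p u v ff)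
  finally have vu: "v \<odot> u = q \<cdot> u" .
  obtain p' q' r where vv: "v \<odot> v = p' \<cdot> f + q' \<cdot> u + r \<cdot> v" by (rule indep3_coords[OF ind])
  have "(v \<odot> v) \<odot> f = 0" by (simp add: v mult_assoc)
  then have "p' \<cdot> f + q' \<cdot> u + 0 \<cdot> v = 0" unfolding vv by (simp add: mult_simps v u ff)
  then have pq: "p' = 0" "q' = 0" using coords_zero by blast+
  have "(v \<odot> v) \<odot> u = v \<odot> (v \<odot> u)" by (simp add: mult_assoc)
  then have "(r * q) \<cdot> u = (q * q) \<cdot> u" by (simp add: vv pq vu mult_simps)
  then have rq: "q = 0 \<or> q = r" using indep3_nonzero[OF ind] by auto
  show ?thesis
  proof (cases "r = 0")
    case True
    then have "isomorphic_to A21"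
      using rq by (intro isomorphic_tableI[OF ind]) (simp add: lincomb_simps u uu vu uv v vv pq ff)
    then show ?thesis by blast
  next
    case r: False
    then have ind': "indep3 f (inverse r \<cdot> v) u"
      using indep3_scale[OF ind, of "inverse r"] by (metis indep3_rotate indep3_swap nonzero_imp_inverse_nonzero)
    show ?thesis
    proof (cases "q = 0")
      case True
      have "isomorphic_to A24"
        by (rule isomorphic_tableI[OF ind']) (simp add: lincomb_simps mult_simps u uu vu uv v vv pq ff r True)
      then show ?thesis by blast
    next
      case False
      have "isomorphic_to A20"
        using rq False
        by (intro isomorphic_tableI[OF indep3_swap[OF ind']])
          (simp add: lincomb_simps mult_simps u uu vu uv v vv pq ff r)
      then show ?thesis by blast
    qed
  qed
qed

end

text \<open>\<open>f\<close> annihilates \<open>w\<close>, so only the Peirce type of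
  \<open>w\<close> for \<open>g\<close> is left to distinguish. In type 11 the corner of
  \<open>g\<close> is two-dimensional and may split further.\<close>

lemma two_idempotents_case:
  assumes ind: "indep3 g f w" and idem: "g \<odot> g = g" "f \<odot> f = f"
    and orth: "g \<odot> f = 0" "f \<odot> g = 0" and w: "f \<odot> w = 0" "w \<odot> f = 0" "peirce g w"
  shows "\<exists>K. listed K \<and> isomorphic_to K"
proof -
  obtain p q r where ww: "w \<odot> w = p \<cdot> g + q \<cdot> f + r \<cdot> w" by (rule indep3_coords[OF ind])
  have "f \<odot> (w \<odot> w) = 0" by (simp add: w flip: mult_assoc)
  then have "q = 0"
    using indep3_nonzero[OF ind] unfolding ww by (simp add: mult_simps idem orth w)
  then have ww: "w \<odot> w = p \<cdot> g + r \<cdot> w" using ww by simp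
  consider "g \<odot> w = w" "w \<odot> g = w" | "g \<odot> w = w" "w \<odot> g = 0" | "g \<odot> w = 0" "w \<odot> g = w"
    | "g \<odot> w = 0" "w \<odot> g = 0"
    using w(3) unfolding peirce_def by blast
  then show ?thesis
  proof cases
    case 1
    obtain c k where ck: "(w - c \<cdot> g) \<odot> (w - c \<cdot> g) = k \<cdot> (w - c \<cdot> g)"
      by (rule quadratic_shift[OF ww idem(1) 1])
    define n where "n = w - c \<cdot> g"
    have ind': "indep3 f g n"
      using indep3_shift[of g w f c] ind unfolding n_def by (metis indep3_rotate indep3_swap)
    have n: "n \<odot> n = k \<cdot> n" "g \<odot> n = n" "n \<odot> g = n" "f \<odot> n = 0" "n \<odot> f = 0"
      using ck by (simp_all add: n_def mult_diff_left mult_diff_right mult_scale_left mult_scale_right 1 w idem orth)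
    show ?thesis
    proof (cases "k = 0")
      case True
      have "isomorphic_to A08"
        by (rule isomorphic_tableI[OF ind']) (simp add: lincomb_simps n idem orth True)
      then show ?thesis by (auto simp: listed_def)
    next
      case False
      have "indep3 f g (inverse k \<cdot> n)" using indep3_scale[OF ind'] False by simp
      \<comment> \<open>\<open>inverse k \<cdot> n\<close> is an idempotent in the corner of
        \<open>g\<close>, and subtracting it from \<open>g\<close> gives the complementary
        one.\<close>
      then have "indep3 (inverse k \<cdot> n) (g - 1 \<cdot> (inverse k \<cdot> n)) f"
        by (metis indep3_rotate indep3_swap indep3_shift)
      then have "isomorphic_to A07"
        by (rule isomorphic_tableI) (simp add: lincomb_simps mult_simps n idem orth False)
      then show ?thesis by (auto simp: listed_def)
    qed
  next
    case 2
    have "w \<odot> w = 0" using 2 by (metis mult_assoc mult_zero_left)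
    then have "isomorphic_to A23"
      by (intro isomorphic_tableI[OF ind]) (simp add: lincomb_simps 2 w idem orth)
    then show ?thesis by (auto simp: listed_def)
  next
    case 3
    have "w \<odot> w = 0" using 3 by (metis mult_assoc mult_zero_right)
    then have "isomorphic_to A24"
      by (intro isomorphic_tableI[OF ind]) (simp add: lincomb_simps 3 w idem orth)
    then show ?thesis by (auto simp: listed_def)
  next
    case 4
    have "g \<odot> (w \<odot> w) = 0" by (simp add: 4 flip: mult_assoc)
    then have "p = 0"
      using indep3_nonzero[OF ind] unfolding ww by (simp add: mult_simps idem 4)
    then have ww: "w \<odot> w = r \<cdot> w" using ww by simp
    show ?thesis
    proof (cases "r = 0")
      case True
      have "isomorphic_to A01"
        by (rule isomorphic_tableI[OF ind]) (simp add: lincomb_simps 4 w idem orth ww True)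
      then show ?thesis by (auto simp: listed_def)
    next
      case False
      have "indep3 g f (inverse r \<cdot> w)" using indep3_scale[OF ind] False by simp
      then have "isomorphic_to A07"
        by (rule isomorphic_tableI) (simp add: lincomb_simps mult_simps 4 w idem orth ww False)
      then show ?thesis by (auto simp: listed_def)
    qed
  qed
qed

text \<open>\<open>u\<close> and \<open>v\<close> span a two-dimensional subalgebra orthogonal to
  \<open>f\<close>. If it is not nil, it contains an idempotent orthogonal to \<open>f\<close>; if
  it is nil, a nonzero square in it decides between \<open>A11\<close> and
  \<open>A03\<close>.\<close>

lemma case_00_00:
  assumes ind: "indep3 f u v" and ff: "f \<odot> f = f"
    and u: "f \<odot> u = 0" "u \<odot> f = 0" and v: "f \<odot> v = 0" "v \<odot> f = 0"
  shows "\<exists>K. listed K \<and> isomorphic_to K"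
proof -
  note f0 = indep3_nonzero(1)[OF ind]
  show ?thesis
  proof (cases "\<exists>x. f \<odot> x = 0 \<and> x \<odot> f = 0 \<and> x \<odot> (x \<odot> (x \<odot> x)) \<noteq> 0")
    case True
    then obtain x where x: "f \<odot> x = 0" "x \<odot> f = 0" "x \<odot> (x \<odot> (x \<odot> x)) \<noteq> 0" by blast
    obtain g y z where g: "g \<noteq> 0" "g \<odot> g = g" "g = y \<odot> x" "g = x \<odot> z"
      by (rule nilpotent_or_idempotent[OF x(3)])
    have orth: "g \<odot> f = 0" "f \<odot> g = 0"
      using g x by (metis mult_assoc mult_zero_left mult_zero_right)+
    obtain w where w: "indep3 g f w" "peirce g w"
      by (rule peirce_basis_orthogonal[OF g(2,1) ff f0 orth])
    obtain p q r where wc: "w = p \<cdot> f + q \<cdot> u + r \<cdot> v" by (rule indep3_coords[OF ind])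
    have fw: "f \<odot> w = p \<cdot> f" "w \<odot> f = p \<cdot> f" unfolding wc by (simp_all add: mult_simps u v ff)
    \<comment> \<open>Removing the \<open>f\<close>-coordinate makes \<open>w'\<close> orthogonal to
      \<open>f\<close>. Its type for \<open>g\<close> is unaffected: either \<open>p = 0\<close>, or
      \<open>g\<close> annihilates both \<open>w\<close> and \<open>f\<close> on both sides.\<close>
    define w' where "w' = w - p \<cdot> f"
    have "indep3 g f w'"
      using indep3_shift[of f w g p] w(1) unfolding w'_def by (metis indep3_rotate indep3_swap)
    moreover have "f \<odot> w' = 0" "w' \<odot> f = 0" by (simp_all add: w'_def mult_simps fw ff)
    moreover have "p = 0" if "g \<odot> w = w \<or> w \<odot> g = w"
    proof -
      have "p \<cdot> f = 0" using that fw orth by (metis mult_assoc mult_zero_left mult_zero_right)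
      then show ?thesis using f0 by simp
    qed
    then have "peirce g w'" using w(2) unfolding peirce_def w'_def by (auto simp: mult_simps orth)
    ultimately show ?thesis using g(2) ff orth by (intro two_idempotents_case[of g f w'])
  next
    case False
    then have nil: "x \<odot> (x \<odot> (x \<odot> x)) = 0" if "f \<odot> x = 0" "x \<odot> f = 0" for x using that by blast
    show ?thesis
    proof (cases "\<exists>x. f \<odot> x = 0 \<and> x \<odot> f = 0 \<and> x \<odot> x \<noteq> 0")
      case True
      then obtain x where x: "f \<odot> x = 0" "x \<odot> f = 0" "x \<odot> x \<noteq> 0" by blast
      have fx: "f \<odot> (x \<odot> y) = 0" for y using x by (metis mult_assoc mult_zero_left)
      have x3: "x \<odot> (x \<odot> x) = 0"
      proof (rule ccontr)
        assume nz: "x \<odot> (x \<odot> x) \<noteq> 0"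
        \<comment> \<open>The powers of \<open>x\<close> would form a basis, yet \<open>f\<close>
          kills each of them from the left.\<close>
        obtain p q r where *: "f = p \<cdot> x + q \<cdot> x \<odot> x + r \<cdot> x \<odot> (x \<odot> x)"
          by (rule indep3_coords[OF indep3_powers[OF nil[OF x(1,2)] nz]])
        have "f \<odot> f = 0" by (subst (2) *) (simp add: mult_simps x fx)
        then show False using ff f0 by simp
      qed
      have "indep3 f x (x \<odot> x)"
      proof (rule indep3I)
        fix p q r assume *: "p \<cdot> f + q \<cdot> x + r \<cdot> x \<odot> x = 0"
        have "f \<odot> (p \<cdot> f + q \<cdot> x + r \<cdot> x \<odot> x) = 0" by (simp add: *)
        then have "p = 0" using f0 by (simp add: mult_simps ff x fx)
        then show "p = 0 \<and> q = 0 \<and> r = 0" using indep2_square[OF x3 x(3)] * by simp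
      qed
      then have "isomorphic_to A11"
        by (rule isomorphic_tableI) (simp add: lincomb_simps ff x x3 fx mult_assoc)
      then show ?thesis by (auto simp: listed_def)
    next
      case False
      have sq: "u \<odot> u = 0" "v \<odot> v = 0" using False u v by blast+
      have prod: "a \<odot> b = 0" if ind: "indep3 f a b" and a: "f \<odot> a = 0" "a \<odot> a = 0"
        and b: "f \<odot> b = 0" "b \<odot> b = 0" for a b
      proof (rule ccontr)
        assume nz: "a \<odot> b \<noteq> 0"
        obtain p q r where ab: "a \<odot> b = p \<cdot> f + q \<cdot> a + r \<cdot> b" by (rule indep3_coords[OF ind])
        have "f \<odot> (a \<odot> b) = 0" by (simp add: a flip: mult_assoc)
        then have p: "p = 0" using f0 unfolding ab by (simp add: mult_simps ff a b)
        have "0 = a \<odot> (a \<odot> b)" by (simp add: a flip: mult_assoc)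
        also have "\<dots> = r \<cdot> (a \<odot> b)" by (subst ab) (simp add: mult_simps p a)
        finally have r: "r = 0" using nz by simp
        have "0 = (a \<odot> b) \<odot> b" by (simp add: b mult_assoc)
        also have "\<dots> = q \<cdot> (a \<odot> b)" by (subst ab) (simp add: mult_simps p r)
        finally show False using nz ab p r by simp
      qed
      have "u \<odot> v = 0" "v \<odot> u = 0"
        using prod[OF ind] prod[OF indep3_swap[OF indep3_rotate[OF indep3_rotate[OF ind]]]] u v sq by blast+
      then have "isomorphic_to A03"
        by (intro isomorphic_tableI[OF ind]) (simp add: lincomb_simps ff u v sq)
      then show ?thesis by (auto simp: listed_def)
    qed
  qed
qed

lemma classification:
  assumes nz: "x \<odot> y \<noteq> 0"
  shows "\<exists>K. listed K \<and> isomorphic_to K"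
proof (cases "\<forall>x. x \<odot> (x \<odot> (x \<odot> x)) = 0")
  case True
  then show ?thesis using nilpotent_classification nz by blast
next
  case False
  then obtain g where "g \<noteq> 0" "g \<odot> g = g" using nilpotent_or_idempotent by metis
  then obtain f where f: "primitive f" by (rule primitive_exists)
  then obtain u v where ind: "indep3 f u v" and uv: "peirce f u" "peirce f v"
    using peirce_basis primitiveD by metis
  have ind': "indep3 f v u" using ind by (metis indep3_rotate indep3_swap)
  have listed: "listed A02" "listed A08" "listed A09" "listed A10" "listed A15" "listed A16" "listed A17"
    "listed A18" "listed A19" "listed A20" "listed A21" "listed A22" "listed A23" "listed A24"
    by (simp_all add: listed_def)
  have types: "(f \<odot> x = x \<and> x \<odot> f = x) \<or> (f \<odot> x = x \<and> x \<odot> f = 0)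
      \<or> (f \<odot> x = 0 \<and> x \<odot> f = x) \<or> (f \<odot> x = 0 \<and> x \<odot> f = 0)" if "peirce f x" for x
    using that unfolding peirce_def by blast
  \<comment> \<open>Sixteen pairs of types; \<open>ind'\<close> exchanges \<open>u\<close> and
    \<open>v\<close>, so one lemma per unordered pair suffices.\<close>
  have "(\<exists>K. listed K \<and> isomorphic_to K)
      \<or> (f \<odot> u = 0 \<and> u \<odot> f = 0 \<and> f \<odot> v = 0 \<and> v \<odot> f = 0)"
    using types[OF uv(1)] types[OF uv(2)]
  proof (elim disjE conjE, goal_cases)
    case 1 show ?case using primitive_unit_case[OF f ind 1] listed by blast
  next
    case 2 show ?case using case_11_10[OF f ind 2] listed by blast
  next
    case 3 show ?case using case_11_01[OF f ind 3] listed by blast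
  next
    case 4 show ?case using case_11_00[OF f ind 4] listed by blast
  next
    case 5 show ?case using case_11_10[OF f ind' 5] listed by blast
  next
    case 6 show ?case using case_11_01[OF f ind' 6] listed by blast
  next
    case 7 show ?case using case_11_00[OF f ind' 7] listed by blast
  next
    case 8 show ?case using case_10_10[OF f ind 8] listed by blast
  next
    case 9 show ?case using case_10_01[OF f ind 9] listed by blast
  next
    case 10 show ?case using case_10_00[OF f ind 10] listed by blast
  next
    case 11 show ?case using case_10_01[OF f ind' 11] listed by blast
  next
    case 12 show ?case using case_10_00[OF f ind' 12] listed by blast
  next
    case 13 show ?case using case_01_01[OF f ind 13] listed by blast
  next
    case 14 show ?case using case_01_00[OF f ind 14] listed by blast
  next
    case 15 show ?case using case_01_00[OF f ind' 15(3,4,1,2)] listed by blast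
  qed simp
  then show ?thesis using case_00_00[OF ind primitiveD(2)[OF f]] by blast
qed

end

subsection \<open>Invariants\<close>

lemmas product_in_simps = table_mult_def basis_product_def commutative_table_def sum_3 vec_eq_iff
  forall_3 axis_def

definition nil_set :: "algebra_name \<Rightarrow> (complex ^ 3) set" where
  "nil_set K = {x. product_in K x (product_in K x (product_in K x x)) = 0}"

definition left_annihilator :: "algebra_name \<Rightarrow> (complex ^ 3) set" where
  "left_annihilator K = {x. \<forall>y. product_in K x y = 0}"

definition right_annihilator :: "algebra_name \<Rightarrow> (complex ^ 3) set" where
  "right_annihilator K = {x. \<forall>y. product_in K y x = 0}"

definition commutative :: "algebra_name \<Rightarrow> bool" where
  "commutative K \<longleftrightarrow> (\<forall>x y. product_in K x y = product_in K y x)"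

text \<open>Separates \<open>A02\<close> from \<open>A11\<close>, \<open>A05\<close> from
  \<open>A06\<close>, \<open>A09\<close> from \<open>A10\<close>, and \<open>A12\<close> from
  \<open>A13\<close> and \<open>A14\<close>.\<close>

definition cube_zero_imp_square_zero :: "algebra_name \<Rightarrow> bool" where
  "cube_zero_imp_square_zero K \<longleftrightarrow>
     (\<forall>x. product_in K x (product_in K x x) = 0 \<longrightarrow> product_in K x x = 0)"

text \<open>Separates \<open>A13\<close>, whose elements of square zero form a plane, from
  \<open>A14\<close>, where they form a union of two planes.\<close>

definition square_zero_add_closed :: "algebra_name \<Rightarrow> bool" where
  "square_zero_add_closed K \<longleftrightarrow>
     (\<forall>x y. product_in K x x = 0 \<longrightarrow> product_in K y y = 0 \<longrightarrow> product_in K (x + y) (x + y) = 0)"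

lemma isomorphic_invariants:
  assumes "algebra_isomorphic (*s) (product_in K) (*s) (product_in L)"
  shows "vec.dim (nil_set K) = vec.dim (nil_set L)"
    "vec.dim (left_annihilator K) = vec.dim (left_annihilator L)"
    "vec.dim (right_annihilator K) = vec.dim (right_annihilator L)"
    "commutative K \<longleftrightarrow> commutative L"
    "cube_zero_imp_square_zero K \<longleftrightarrow> cube_zero_imp_square_zero L"
    "square_zero_add_closed K \<longleftrightarrow> square_zero_add_closed L"
proof -
  obtain f where lin: "Vector_Spaces.linear (*s) (*s) f" and bij: "bij f"
    and hom: "\<And>x y. f (product_in K x y) = product_in L (f x) (f y)"
    using assms unfolding algebra_isomorphic_def by blast
  interpret f: Vector_Spaces.linear "(*s)" "(*s)" f by fact
  have inj: "f x = f y \<longleftrightarrow> x = y" for x y using bij by (auto simp: bij_def inj_def)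
  have zero: "f x = 0 \<longleftrightarrow> x = 0" for x using inj[of x 0] by simp
  \<comment> \<open>Pulls quantifiers over the target back along \<open>f\<close>, after which
    \<open>hom\<close>, \<open>zero\<close> and \<open>inj\<close> turn the property of
    \<open>L\<close> into that of \<open>K\<close>. It is instantiated below because it would match
    any universal quantifier.\<close>
  have all: "(\<forall>y. P y) \<longleftrightarrow> (\<forall>x. P (f x))" for P using bij by (metis bij_pointE)
  have image: "f ` {x. P (f x)} = {y. P y}" for P using bij by (auto simp: bij_def surj_def)
  have dim: "vec.dim (f ` S) = vec.dim S" for S
    using bij by (intro vec.dim_image_eq lin) (auto simp: bij_def inj_on_def inj_def)
  have "nil_set K = {x. f x \<in> nil_set L}"
    "left_annihilator K = {x. f x \<in> left_annihilator L}"
    "right_annihilator K = {x. f x \<in> right_annihilator L}"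
    unfolding nil_set_def left_annihilator_def right_annihilator_def all[of "\<lambda>y. product_in L _ y = 0"]
      all[of "\<lambda>y. product_in L y _ = 0"] mem_Collect_eq hom[symmetric] zero by (rule refl)+
  then show "vec.dim (nil_set K) = vec.dim (nil_set L)"
    "vec.dim (left_annihilator K) = vec.dim (left_annihilator L)"
    "vec.dim (right_annihilator K) = vec.dim (right_annihilator L)"
    using dim image[of "\<lambda>y. y \<in> _"] by (metis Collect_mem_eq)+
  show "commutative K \<longleftrightarrow> commutative L"
    unfolding commutative_def all[of "\<lambda>y. \<forall>z. product_in L y z = product_in L z y"]
      all[of "\<lambda>z. product_in L (f _) z = product_in L z (f _)"] hom[symmetric] inj ..
  show "cube_zero_imp_square_zero K \<longleftrightarrow> cube_zero_imp_square_zero L"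
    unfolding cube_zero_imp_square_zero_def
      all[of "\<lambda>x. product_in L x (product_in L x x) = 0 \<longrightarrow> product_in L x x = 0"] hom[symmetric] zero ..
  show "square_zero_add_closed K \<longleftrightarrow> square_zero_add_closed L"
    unfolding square_zero_add_closed_def
      all[of "\<lambda>x. \<forall>y. product_in L x x = 0 \<longrightarrow> product_in L y y = 0 \<longrightarrow> product_in L (x + y) (x + y) = 0"]
      all[of "\<lambda>y. product_in L (f _) (f _) = 0 \<longrightarrow> product_in L y y = 0 \<longrightarrow> product_in L (f _ + y) (f _ + y) = 0"]
    unfolding f.add[symmetric] hom[symmetric] zero ..
qed

fun nil_support :: "algebra_name \<Rightarrow> 3 set" where
  "nil_support A01 = {3}"
| "nil_support A02 = {2, 3}"
| "nil_support A03 = {2, 3}"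
| "nil_support A07 = {}"
| "nil_support A08 = {3}"
| "nil_support A09 = {2, 3}"
| "nil_support A10 = {2, 3}"
| "nil_support A11 = {2, 3}"
| "nil_support A15 = {2, 3}"
| "nil_support A16 = {2, 3}"
| "nil_support A17 = {2, 3}"
| "nil_support A18 = {2, 3}"
| "nil_support A19 = {2, 3}"
| "nil_support A20 = {3}"
| "nil_support A21 = {2, 3}"
| "nil_support A22 = {2, 3}"
| "nil_support A23 = {3}"
| "nil_support A24 = {3}"
| "nil_support _ = {1, 2, 3}"

text \<open>For each table the nilpotent elements form a coordinate subspace, so its dimension is a
  count of indices.\<close>

lemma dim_nil_set: "vec.dim (nil_set K) = card (nil_support K)"
proof -
  have "nil_set K = {x. \<forall>i. i \<notin> nil_support K \<longrightarrow> x $ i = 0}"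
    by (cases K) (auto simp: nil_set_def product_in_simps)
  then show ?thesis by (simp add: dim_substandard_cart)
qed

text \<open>
  Here and for the right annihilators, the values at \<open>A12\<close>, \<open>A13\<close> and \<open>A14 \<alpha>\<close> are junk.
\<close>

fun left_annihilator_support :: "algebra_name \<Rightarrow> 3 set" where
  "left_annihilator_support A01 = {3}"
| "left_annihilator_support A02 = {3}"
| "left_annihilator_support A03 = {2, 3}"
| "left_annihilator_support A04 = {2, 3}"
| "left_annihilator_support A05 = {3}"
| "left_annihilator_support A06 = {3}"
| "left_annihilator_support A11 = {3}"
| "left_annihilator_support A15 = {2}"
| "left_annihilator_support A17 = {2, 3}"
| "left_annihilator_support A19 = {3}"
| "left_annihilator_support A21 = {3}"
| "left_annihilator_support A22 = {2, 3}"
| "left_annihilator_support A23 = {3}"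
| "left_annihilator_support _ = {}"

fun right_annihilator_support :: "algebra_name \<Rightarrow> 3 set" where
  "right_annihilator_support A01 = {3}"
| "right_annihilator_support A02 = {3}"
| "right_annihilator_support A03 = {2, 3}"
| "right_annihilator_support A04 = {2, 3}"
| "right_annihilator_support A05 = {3}"
| "right_annihilator_support A06 = {3}"
| "right_annihilator_support A11 = {3}"
| "right_annihilator_support A16 = {2}"
| "right_annihilator_support A18 = {2, 3}"
| "right_annihilator_support A19 = {2}"
| "right_annihilator_support A21 = {2, 3}"
| "right_annihilator_support A22 = {3}"
| "right_annihilator_support A24 = {3}"
| "right_annihilator_support _ = {}"

text \<open>Products with the three basis vectors already give all coordinate conditions. For
  \<open>A14 \<alpha>\<close> the dimension depends on whether \<open>\<alpha>\<close> is 1 or -1,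
  so no single support fits.\<close>

lemma dim_left_annihilator:
  assumes "K \<notin> {A12, A13} \<union> range A14"
  shows "vec.dim (left_annihilator K) = card (left_annihilator_support K)"
proof -
  have "(\<forall>y. product_in K x y = 0) \<longleftrightarrow> (\<forall>i. i \<notin> left_annihilator_support K \<longrightarrow> x $ i = 0)" for x
  proof
    assume "\<forall>y. product_in K x y = 0"
    then have "\<forall>i. product_in K x (e i) = 0" by blast
    then show "\<forall>i. i \<notin> left_annihilator_support K \<longrightarrow> x $ i = 0"
      using assms by (cases K) (auto simp: product_in_simps)
  next
    assume "\<forall>i. i \<notin> left_annihilator_support K \<longrightarrow> x $ i = 0"
    then show "\<forall>y. product_in K x y = 0"
      using assms by (cases K) (auto simp: product_in_simps)
  qed
  then show ?thesis by (simp add: left_annihilator_def dim_substandard_cart)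
qed

lemma dim_right_annihilator:
  assumes "K \<notin> {A12, A13} \<union> range A14"
  shows "vec.dim (right_annihilator K) = card (right_annihilator_support K)"
proof -
  have "(\<forall>y. product_in K y x = 0) \<longleftrightarrow> (\<forall>i. i \<notin> right_annihilator_support K \<longrightarrow> x $ i = 0)" for x
  proof
    assume "\<forall>y. product_in K y x = 0"
    then have "\<forall>i. product_in K (e i) x = 0" by blast
    then show "\<forall>i. i \<notin> right_annihilator_support K \<longrightarrow> x $ i = 0"
      using assms by (cases K) (auto simp: product_in_simps)
  next
    assume "\<forall>i. i \<notin> right_annihilator_support K \<longrightarrow> x $ i = 0"
    then show "\<forall>y. product_in K y x = 0"
      using assms by (cases K) (auto simp: product_in_simps)
  qed
  then show ?thesis by (simp add: right_annihilator_def dim_substandard_cart)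
qed

lemma commutative_iff:
  assumes "listed K"
  shows "commutative K \<longleftrightarrow> K \<in> {A01, A02, A03, A04, A05, A06, A07, A08, A09, A10, A11}"
proof
  assume "commutative K"
  then have "\<forall>i j. product_in K (e i) (e j) = product_in K (e j) (e i)"
    unfolding commutative_def by blast
  then show "K \<in> {A01, A02, A03, A04, A05, A06, A07, A08, A09, A10, A11}"
    using assms by (cases K) (auto simp: product_in_simps listed_def)
next
  assume "K \<in> {A01, A02, A03, A04, A05, A06, A07, A08, A09, A10, A11}"
  then show "commutative K" unfolding commutative_def using product_in_commute by blast
qed

lemma not_cube_zero_imp_square_zeroI:
  assumes "product_in K x (product_in K x x) = 0" "product_in K x x \<noteq> 0"
  shows "\<not> cube_zero_imp_square_zero K"
  using assms unfolding cube_zero_imp_square_zero_def by blast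

lemma cube_zero_imp_square_zero_simps:
  "cube_zero_imp_square_zero A02" "\<not> cube_zero_imp_square_zero A05"
  "cube_zero_imp_square_zero A06" "cube_zero_imp_square_zero A09"
  "\<not> cube_zero_imp_square_zero A10" "\<not> cube_zero_imp_square_zero A11"
  "cube_zero_imp_square_zero A12" "\<not> cube_zero_imp_square_zero A13"
  "\<not> cube_zero_imp_square_zero (A14 \<alpha>)"
proof -
  show "cube_zero_imp_square_zero A02" "cube_zero_imp_square_zero A06"
    "cube_zero_imp_square_zero A09" "cube_zero_imp_square_zero A12"
    by (auto simp: cube_zero_imp_square_zero_def product_in_simps)
  \<comment> \<open>In \<open>A14 \<alpha>\<close> the square of \<open>e 1 + e 2\<close> is twice
    \<open>e 3\<close> for every \<open>\<alpha>\<close>, because the skew part cancels.\<close>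
  show "\<not> cube_zero_imp_square_zero A05" "\<not> cube_zero_imp_square_zero (A14 \<alpha>)"
    by (rule not_cube_zero_imp_square_zeroI[of _ "e 1 + e 2"]; simp add: product_in_simps)+
  show "\<not> cube_zero_imp_square_zero A10" "\<not> cube_zero_imp_square_zero A11"
    by (rule not_cube_zero_imp_square_zeroI[of _ "e 2"]; simp add: product_in_simps)+
  show "\<not> cube_zero_imp_square_zero A13"
    by (rule not_cube_zero_imp_square_zeroI[of _ "e 1"]; simp add: product_in_simps)
qed

lemma square_zero_add_closed_simps:
  "square_zero_add_closed A13" "\<not> square_zero_add_closed (A14 \<alpha>)"
proof -
  show "square_zero_add_closed A13"
    by (auto simp: square_zero_add_closed_def product_in_simps)
  have "product_in (A14 \<alpha>) (e 1) (e 1) = 0" "product_in (A14 \<alpha>) (e 2) (e 2) = 0"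
    "product_in (A14 \<alpha>) (e 1 + e 2) (e 1 + e 2) \<noteq> 0"
    by (simp_all add: product_in_simps)
  then show "\<not> square_zero_add_closed (A14 \<alpha>)"
    unfolding square_zero_add_closed_def by blast
qed

section \<open>The parameter of \<open>A14\<close>\<close>

lemma product_in_A14:
  "product_in (A14 \<alpha>) x y = ((1 + \<alpha>) * (x $ 1 * y $ 2) + (1 - \<alpha>) * (x $ 2 * y $ 1)) *s e 3"
  by (simp add: product_in_simps algebra_simps)

lemma isomorphic_A14_D:
  assumes "algebra_isomorphic (*s) (product_in (A14 \<alpha>)) (*s) (product_in (A14 \<beta>))"
  shows "\<beta> = \<alpha> \<or> \<beta> = - \<alpha>"
proof -
  obtain f where lin: "Vector_Spaces.linear (*s) (*s) f" and bij: "bij f"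
    and hom: "\<And>x y. f (product_in (A14 \<alpha>) x y) = product_in (A14 \<beta>) (f x) (f y)"
    using assms unfolding algebra_isomorphic_def by blast
  interpret f: Vector_Spaces.linear "(*s)" "(*s)" f by fact
  define x y w where "x = f (e 1)" and "y = f (e 2)" and "w = f (e 3)"
  have "e 3 \<noteq> (0 :: complex ^ 3)" by (simp add: axis_eq_0_iff)
  then have w: "w \<noteq> 0" unfolding w_def using bij f.zero by (metis bij_pointE)
  have "product_in (A14 \<alpha>) (e 1) (e 2) = (1 + \<alpha>) *s e 3" "product_in (A14 \<alpha>) (e 2) (e 1) = (1 - \<alpha>) *s e 3"
    "product_in (A14 \<alpha>) (e 1) (e 1) = 0" "product_in (A14 \<alpha>) (e 2) (e 2) = 0"
    by (simp_all add: product_in_A14 axis_def del: table.simps)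
  then have xy: "product_in (A14 \<beta>) x y = (1 + \<alpha>) *s w" "product_in (A14 \<beta>) y x = (1 - \<alpha>) *s w"
    and sq: "product_in (A14 \<beta>) x x = 0" "product_in (A14 \<beta>) y y = 0"
    unfolding x_def y_def w_def by (metis hom f.scale f.zero)+
  have "(1 + \<beta>) * (x $ 1 * y $ 2) + (1 - \<beta>) * (x $ 2 * y $ 1) = (1 + \<alpha>) * w $ 3"
    "(1 + \<beta>) * (y $ 1 * x $ 2) + (1 - \<beta>) * (y $ 2 * x $ 1) = (1 - \<alpha>) * w $ 3"
    "x $ 1 * x $ 2 = 0" "y $ 1 * y $ 2 = 0"
    "(1 + \<alpha>) * w $ 1 = 0 \<and> (1 - \<alpha>) * w $ 1 = 0" "(1 + \<alpha>) * w $ 2 = 0 \<and> (1 - \<alpha>) * w $ 2 = 0"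
    using xy sq unfolding product_in_A14 by (auto simp: vec_eq_iff forall_3 axis_def algebra_simps)
  note * = this
  \<comment> \<open>\<open>1 + \<alpha>\<close> and \<open>1 - \<alpha>\<close> add up to 2, so they
    cannot both vanish.\<close>
  have "w $ 1 = 0" "w $ 2 = 0" using *(5,6) by auto
  then have w3: "w $ 3 \<noteq> 0" using w by (simp add: vec_eq_iff forall_3)
  \<comment> \<open>One of them vanishes since \<open>x\<close> and \<open>y\<close> have square
    zero: \<open>q = 0\<close> when the two planes are preserved, \<open>p = 0\<close> when they are
    swapped. The sum and difference of the mixed products then compare the parameters.\<close>
  define p q where "p = x $ 1 * y $ 2" and "q = x $ 2 * y $ 1"
  have eqs: "(1 + \<beta>) * p + (1 - \<beta>) * q = (1 + \<alpha>) * w $ 3" "(1 + \<beta>) * q + (1 - \<beta>) * p = (1 - \<alpha>) * w $ 3"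
    using *(1,2) by (simp_all add: p_def q_def mult.commute)
  have "2 * (p + q) = 2 * w $ 3" "2 * (\<beta> * (p - q)) = 2 * (\<alpha> * w $ 3)"
    using eqs by algebra+
  then have sum: "p + q = w $ 3" and diff: "\<beta> * (p - q) = \<alpha> * w $ 3"
    unfolding mult_cancel_left by simp_all
  have "p = 0 \<or> q = 0" using *(3) by (auto simp: p_def q_def)
  then show ?thesis
  proof
    assume "p = 0"
    then have "(\<beta> + \<alpha>) * w $ 3 = 0" using sum diff by algebra
    then show ?thesis using w3 by (simp add: eq_neg_iff_add_eq_0)
  next
    assume "q = 0"
    then show ?thesis using sum diff w3 by simp
  qed
qed

lemma isomorphic_A14_uminus:
  "algebra_isomorphic (*s) (product_in (A14 \<alpha>)) (*s) (product_in (A14 (- \<alpha>)))"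
proof -
  let ?f = "\<lambda>v :: complex ^ 3. vector [v $ 2, v $ 1, v $ 3] :: complex ^ 3"
  have "Vector_Spaces.linear (*s) (*s) ?f"
    by unfold_locales (simp_all add: vec_eq_iff forall_3 algebra_simps)
  moreover have "?f (?f v) = v" for v by (simp add: vec_eq_iff forall_3)
  then have "bij ?f" by (intro o_bij[of ?f ?f]) auto
  moreover have "?f (product_in (A14 \<alpha>) x y) = product_in (A14 (- \<alpha>)) (?f x) (?f y)" for x y
    by (simp add: product_in_simps)
  ultimately show ?thesis unfolding algebra_isomorphic_def by blast
qed

section \<open>Separating the listed algebras\<close>

lemma isomorphic_refl: "algebra_isomorphic (*s) (product_in K) (*s) (product_in K)"
  unfolding algebra_isomorphic_def using vec.linear_id bij_id by (metis id_apply)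

text \<open>Annihilators are compared only away from \<open>A12\<close>, \<open>A13\<close> and
  \<open>A14\<close>. These are exactly the listed noncommutative algebras in which every element is
  nilpotent, so \<open>nil\<close> and \<open>comm\<close> already set them apart from the
  others.\<close>

lemma isomorphic_imp:
  assumes iso: "algebra_isomorphic (*s) (product_in K) (*s) (product_in L)"
    and listed: "listed K" "listed L"
  shows "K = L \<or> (\<exists>\<alpha>. K = A14 \<alpha> \<and> L = A14 (- \<alpha>))"
proof -
  note inv = isomorphic_invariants[OF iso]
  note nil = inv(1)[unfolded dim_nil_set]
  have left: "K \<notin> {A12, A13} \<union> range A14 \<Longrightarrow> L \<notin> {A12, A13} \<union> range A14 \<Longrightarrow>
      card (left_annihilator_support K) = card (left_annihilator_support L)"
    using inv(2) dim_left_annihilator by metis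
  have right: "K \<notin> {A12, A13} \<union> range A14 \<Longrightarrow> L \<notin> {A12, A13} \<union> range A14 \<Longrightarrow>
      card (right_annihilator_support K) = card (right_annihilator_support L)"
    using inv(3) dim_right_annihilator by metis
  note comm = inv(4)[unfolded commutative_iff[OF listed(1)] commutative_iff[OF listed(2)]]
  have A14: "\<forall>\<alpha> \<beta>. K = A14 \<alpha> \<longrightarrow> L = A14 \<beta> \<longrightarrow> \<beta> = \<alpha> \<or> \<beta> = - \<alpha>"
    using isomorphic_A14_D iso by blast
  show ?thesis
    using nil left right comm inv(5,6) A14
    by (cases K; cases L;
        simp add: image_iff cube_zero_imp_square_zero_simps square_zero_add_closed_simps; metis)
qed

theorem theorem10:
  fixes scale :: "complex \<Rightarrow> 'a::ab_group_add \<Rightarrow> 'a"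
    and mult :: "'a \<Rightarrow> 'a \<Rightarrow> 'a"
  shows "(associative_algebra scale mult \<and> vector_space.dim scale UNIV = 3 \<and> (\<exists>x y. mult x y \<noteq> 0)
            \<longrightarrow> (\<exists>K. listed K \<and> algebra_isomorphic scale mult (*s) (product_in K)))
    \<and> (\<forall>K L. listed K \<and> listed L \<longrightarrow>
          (algebra_isomorphic (*s) (product_in K) (*s) (product_in L)
             \<longleftrightarrow> K = L \<or> (\<exists>\<alpha>. K = A14 \<alpha> \<and> L = A14 (- \<alpha>))))"
proof (intro conjI allI impI)
  assume A: "associative_algebra scale mult \<and> vector_space.dim scale UNIV = 3 \<and> (\<exists>x y. mult x y \<noteq> 0)"
  then interpret associative_algebra scale mult by blast
  obtain B where B: "independent B" "UNIV \<subseteq> span B" "card B = 3"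
    using basis_exists[of UNIV] A by metis
  \<comment> \<open>\<open>card\<close> of an infinite set is 0, so \<open>card B = 3\<close> also
    gives finiteness of the basis.\<close>
  interpret threedim_algebra scale mult B
    using A B by unfold_locales (auto intro: card_ge_0_finite)
  show "\<exists>K. listed K \<and> algebra_isomorphic scale mult (*s) (product_in K)"
    using A classification by blast
next
  fix K L assume "listed K \<and> listed L"
  then show "algebra_isomorphic (*s) (product_in K) (*s) (product_in L)
      \<longleftrightarrow> K = L \<or> (\<exists>\<alpha>. K = A14 \<alpha> \<and> L = A14 (- \<alpha>))"
    using isomorphic_imp isomorphic_refl isomorphic_A14_uminus by blast
qed

end
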